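(* Let $G_n$ be the size of the greedy independent set on a uniform Cayley tree $\mathcal{T}_n$ of size $n$. For every $n\ge 1$ there exists a random variable $\mathcal{E}_n$ with values in $\{0,1\}$ (defined on the same probability space as $G_n$) such that $$G_n\stackrel{(d)}{=}(n-G_n)+\mathcal{E}_n .$$ Moreover, $\mathbb{P}(\mathcal{E}_n=1)\to 1/4$ as $n\to\infty$.
   Context: A Cayley tree of size $n$ is an unrooted, unordered tree on the labeled vertex set $\{1,\dots,n\}$; $\mathcal{T}_n$ is uniformly random among the $n^{n-2}$ Cayley trees of size $n$. The symbol $\stackrel{(d)}{=}$ denotes equality in distribution. Greedy independent set of a finite graph with vertex set $V$: vertices have one of three statuses, undetermined ($\mathcal{U}_k$), active ($\mathcal{A}_k$), blocked ($\mathcal{B}_k$). Initially $\mathcal{U}_0=V$, $\mathcal{A}_0=\mathcal{B}_0=\emptyset$. At each step $k\ge 1$, an undetermined vertex $v_k$ is chosen uniformly at random among the currently undetermined vertices (given the graph and the past choices), its status is changed to active, and the status of all its undetermined neighbours is changed to blocked. The procedure stops at $\tau=\min\{k\ge 0:\mathcal{U}_k=\emptyset\}$, and $\mathcal{A}_\tau$ is the greedy independent set. $G_n$ is $|\mathcal{A}_\tau|$ when the graph is $\mathcal{T}_n$. The probability space may be chosen freely as long as it carries a variable $G_n$ with this law. *)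

theory Defs
  imports "HOL-Probability.Probability"
begin

text \<open>
  A finite simple graph is given by its vertex set \<open>V\<close> and its set \<open>E\<close> of edges, each edge being
  a two-element set of vertices.
\<close>

definition simple_graph :: "'a set \<Rightarrow> 'a set set \<Rightarrow> bool" where
  "simple_graph V E \<longleftrightarrow> finite V \<and> E \<subseteq> {{u, v} |u v. u \<in> V \<and> v \<in> V \<and> u \<noteq> v}"

definition graph_connected :: "'a set \<Rightarrow> 'a set set \<Rightarrow> bool" where
  "graph_connected V E \<longleftrightarrow> V \<noteq> {} \<and> (\<forall>u\<in>V. \<forall>v\<in>V. (\<lambda>x y. {x, y} \<in> E)\<^sup>*\<^sup>* u v)"

definition graph_cycle :: "'a set set \<Rightarrow> 'a list \<Rightarrow> bool" where
  "graph_cycle E xs \<longleftrightarrow> length xs \<ge> 3 \<and> distinct xs \<and>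
     successively (\<lambda>x y. {x, y} \<in> E) xs \<and> {last xs, hd xs} \<in> E"

definition is_tree :: "'a set \<Rightarrow> 'a set set \<Rightarrow> bool" where
  "is_tree V E \<longleftrightarrow> simple_graph V E \<and> graph_connected V E \<and> (\<nexists>xs. graph_cycle E xs)"

definition cayley_trees :: "nat \<Rightarrow> nat set set set" where
  "cayley_trees n = {E. is_tree {1..n} E}"

text \<open>
  The following two facts ensure that \<open>pmf_of_set (cayley_trees n)\<close> is the uniform distribution.
\<close>

lemma finite_cayley_trees: "finite (cayley_trees n)"
proof (rule finite_subset)
  show "cayley_trees n \<subseteq> Pow (Pow {1..n})"
    by (fastforce simp: cayley_trees_def is_tree_def simple_graph_def)
qed auto

lemma cayley_trees_nonempty:
  assumes "n \<ge> 1"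
  shows "cayley_trees n \<noteq> {}"
proof -
  define E where "E = {{1, k} |k. k \<in> {2..n}}"
  have simple: "simple_graph {1..n} E"
    using assms by (fastforce simp: simple_graph_def E_def)
  let ?R = "\<lambda>x y. {x, y} \<in> E"
  have from1: "?R\<^sup>*\<^sup>* 1 v" and to1: "?R\<^sup>*\<^sup>* v 1" if "v \<in> {1..n}" for v
  proof -
    have "v = 1 \<or> ({1, v} \<in> E \<and> {v, 1} \<in> E)"
      using that unfolding E_def by (cases "v = 1") (auto simp: insert_commute)
    then show "?R\<^sup>*\<^sup>* 1 v" "?R\<^sup>*\<^sup>* v 1"
      by auto
  qed
  have "graph_connected {1..n} E"
    unfolding graph_connected_def
    using assms rtranclp_trans[OF to1 from1] by simp
  moreover have "\<not> graph_cycle E xs" for xs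
  proof
    assume "graph_cycle E xs"
    then obtain a b c ys where xs: "xs = a # b # c # ys" and d: "distinct xs"
      and e: "{a, b} \<in> E" "{b, c} \<in> E" "{last (c # ys), a} \<in> E"
      unfolding graph_cycle_def
      by (cases xs; cases "tl xs"; cases "tl (tl xs)") auto
    have centre: "1 \<in> e" if "e \<in> E" for e
      using that by (auto simp: E_def)
    have "last (c # ys) \<in> set (c # ys)"
      by (rule last_in_set) simp
    then have "last (c # ys) \<noteq> a" "last (c # ys) \<noteq> b" "a \<noteq> b" "b \<noteq> c" "a \<noteq> c"
      using d xs by auto
    then show False
      using centre[OF e(1)] centre[OF e(2)] centre[OF e(3)] by (metis insertE singletonD)
  qed
  ultimately show ?thesis
    using simple by (auto simp: cayley_trees_def is_tree_def)
qed

text \<open>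
  Law of the final active set when the procedure on the graph with edge set \<open>E\<close> is continued from
  the state with undetermined vertices \<open>U\<close> and active vertices \<open>A\<close>; the blocked vertices are all
  the others and do not influence the evolution. Infinite \<open>U\<close> is a dummy case.
\<close>

function greedy_run :: "'a set set \<Rightarrow> 'a set \<Rightarrow> 'a set \<Rightarrow> 'a set pmf" where
  "greedy_run E U A =
     (if U = {} \<or> infinite U then return_pmf A
      else bind_pmf (pmf_of_set U)
        (\<lambda>v. greedy_run E (U - insert v {w. {v, w} \<in> E}) (insert v A)))"
  by pat_completeness auto
termination
  by (relation "Wellfounded.measure (\<lambda>(E, U, A). card U)")
    (auto intro!: psubset_card_mono)

declare greedy_run.simps [simp del]

definition greedy_independent_set :: "'a set \<Rightarrow> 'a set set \<Rightarrow> 'a set pmf" where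
  "greedy_independent_set V E = greedy_run E V {}"

definition greedy_size_law :: "nat \<Rightarrow> nat pmf" where
  "greedy_size_law n =
     bind_pmf (pmf_of_set (cayley_trees n))
       (\<lambda>T. map_pmf card (greedy_independent_set {1..n} T))"

end

theory Submission
  imports Defs "HOL-Real_Asymp.Real_Asymp"
begin

text \<open>
  The law of \<open>G\<^sub>n\<close> is explicit: \<open>P(G\<^sub>n = k)\<close> is
  \<open>(n choose k) k\<^bsup>n-k\<^esup> (n-k)\<^bsup>k-1\<^esup> / n\<^bsup>n-1\<^esup>\<close>, which is also the law of the number of
  vertices at even height in a uniform rooted Cayley tree (choose the \<open>k\<close> even vertices, a spanning
  tree of the complete bipartite graph, and a root among the even vertices). Everything follows
  from this formula (\<open>pmf_greedy_size_law\<close>).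

  \<^bold>\<open>The law.\<close> After some steps, the undetermined vertices \<open>U\<close> carry a forest whose components hang on
  the set \<open>X\<close> of blocked vertices. Orienting all edges towards \<open>X\<close> turns such a state into a map
  \<open>f : U \<rightarrow> U \<union> X\<close> all of whose orbits reach \<open>X\<close>, a parent map. Choose a vertex \<open>v \<in> U\<close>, let \<open>D\<close> be
  its set of neighbours in \<open>U\<close> and \<open>U' = U - v - D\<close>. The restriction of \<open>f\<close> to \<open>U'\<close> is again a parent
  map, with \<open>X \<union> D\<close> in place of \<open>X\<close>. To reconstruct \<open>f\<close>, either the parent of \<open>v\<close> is an element of
  \<open>X\<close>, or it is some \<open>p \<in> D\<close>, and then the parent of \<open>p\<close> is a vertex of \<open>X \<union> U'\<close> that reaches \<open>X\<close>
  without using \<open>D\<close> (\<open>card_graft_fibre\<close>). The number of such vertices depends on the map, but all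
  elements of \<open>X \<union> D\<close> play the same role, so on average a fraction \<open>|X| / |X \<union> D|\<close> of \<open>U'\<close> reaches
  \<open>X\<close> (\<open>forest_sum_reaching\<close>). This gives a recursion in \<open>|X|\<close>, \<open>|U|\<close> and the number of active
  vertices (\<open>forest_sum_Suc\<close>), which is solved by a product formula
  (\<open>forest_sum_eq_weight\<close>). Cayley trees enter at the first step only: rooting a tree at the first
  chosen vertex is a bijection from trees to parent maps (\<open>bij_betw_parent_maps_trees\<close>).

  \<^bold>\<open>The coupling.\<close> With \<open>p k = P(G\<^sub>n = k)\<close>, a variable \<open>\<E>\<^sub>n\<close> as required exists iff the difference
  \<open>P(n - G\<^sub>n \<le> j) - P(G\<^sub>n \<le> j)\<close> always lies between \<open>0\<close> and \<open>p (n - j)\<close>: it has to be the probability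
  that \<open>n - G\<^sub>n = j\<close> and \<open>\<E>\<^sub>n = 1\<close>. Both bounds say that partial sums of a sequence with total \<open>0\<close> are
  nonnegative, and hold because the sequence is first nonnegative and then nonpositive
  (\<open>partial_sums_nonneg_if_sign_change\<close>).

  \<^bold>\<open>The limit.\<close> Necessarily \<open>P(\<E>\<^sub>n = 1) = E[2 G\<^sub>n - n]\<close>. Abel-type sums evaluate this as
  \<open>n (1 - 2 A\<^sub>n)\<close> with \<open>A\<^sub>n = \<Sum>h. (-1)\<^bsup>h\<^esup> q h\<close> and \<open>q h = n (n-1) \<dots> (n-h+1) / n\<^bsup>h\<^esup>\<close>. The numbers
  \<open>q h\<close> vary slowly with \<open>h\<close> (on the scale \<open>\<surd>n\<close>), so that Euler summation applies: the first terms of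
  repeated differences give \<open>1/4\<close>, and the absolute values of what remains sum to at most the order
  \<open>(\<Sum>h. q h) / n\<close>, which tends to \<open>0\<close>.
\<close>

section \<open>The greedy procedure, one step at a time\<close>

text \<open>
  Active vertices do not influence the run, so the number of vertices that are activated later can be
  studied through runs with no active vertex at the start.
\<close>

lemma greedy_run_active:
  assumes "finite U"
  shows "greedy_run E U A = map_pmf ((\<union>) A) (greedy_run E U {})"
  using assms
proof (induction "card U" arbitrary: U A rule: less_induct)
  case less
  show ?case
  proof (cases "U = {}")
    case True
    then show ?thesis by (simp add: greedy_run.simps[of E "{}"])
  next
    case False
    let ?U = "\<lambda>v. U - insert v {w. {v, w} \<in> E}"
    have IH: "greedy_run E (?U v) B = map_pmf ((\<union>) B) (greedy_run E (?U v) {})" if "v \<in> U" for v B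
      using that less.prems by (intro less.hyps psubset_card_mono) auto
    have "greedy_run E U A = pmf_of_set U \<bind> (\<lambda>v. greedy_run E (?U v) (insert v A))"
      using False less.prems by (subst greedy_run.simps) simp
    also have "\<dots> = pmf_of_set U \<bind> (\<lambda>v. map_pmf ((\<union>) A) (greedy_run E (?U v) {v}))"
    proof (rule bind_pmf_cong[OF refl])
      fix v assume "v \<in> set_pmf (pmf_of_set U)"
      then have v: "v \<in> U" using False less.prems by simp
      show "greedy_run E (?U v) (insert v A) = map_pmf ((\<union>) A) (greedy_run E (?U v) {v})"
        unfolding IH[OF v, of "insert v A"] IH[OF v, of "{v}"]
        by (auto simp: map_pmf_comp intro!: map_pmf_cong)
    qed
    also have "\<dots> = map_pmf ((\<union>) A) (greedy_run E U {})"
      using False less.prems by (subst (2) greedy_run.simps) (simp add: map_bind_pmf)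
    finally show ?thesis .
  qed
qed

lemma set_pmf_greedy_run:
  assumes "finite U" and "B \<in> set_pmf (greedy_run E U A)"
  shows "A \<subseteq> B" "B \<subseteq> A \<union> U"
proof -
  have "A \<subseteq> B \<and> B \<subseteq> A \<union> U"
    using assms
  proof (induction "card U" arbitrary: U A rule: less_induct)
    case less
    show ?case
    proof (cases "U = {}")
      case True
      then show ?thesis using less.prems by (simp add: greedy_run.simps[of E "{}"])
    next
      case False
      then obtain v where v: "v \<in> U" "B \<in> set_pmf (greedy_run E (U - insert v {w. {v, w} \<in> E}) (insert v A))"
        using less.prems by (subst (asm) greedy_run.simps) auto
      then have "insert v A \<subseteq> B \<and> B \<subseteq> insert v A \<union> (U - insert v {w. {v, w} \<in> E})"
        using less.prems by (intro less.hyps psubset_card_mono) auto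
      then show ?thesis using v by auto
    qed
  qed
  then show "A \<subseteq> B" "B \<subseteq> A \<union> U" by auto
qed

lemma greedy_run_edges_cong:
  assumes "finite U" and "\<And>u w. u \<in> U \<Longrightarrow> w \<in> U \<Longrightarrow> u \<noteq> w \<Longrightarrow> {u, w} \<in> E \<longleftrightarrow> {u, w} \<in> E'"
  shows "greedy_run E U A = greedy_run E' U A"
  using assms
proof (induction "card U" arbitrary: U A rule: less_induct)
  case less
  show ?case
  proof (cases "U = {}")
    case True
    then show ?thesis by (simp add: greedy_run.simps[of _ "{}"])
  next
    case False
    have "greedy_run E (U - insert v {w. {v, w} \<in> E}) (insert v A)
        = greedy_run E' (U - insert v {w. {v, w} \<in> E'}) (insert v A)" if v: "v \<in> U" for v
    proof -
      have "U - insert v {w. {v, w} \<in> E} = U - insert v {w. {v, w} \<in> E'}"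
        using less.prems(2)[OF v] by auto
      moreover have "greedy_run E (U - insert v {w. {v, w} \<in> E}) (insert v A)
        = greedy_run E' (U - insert v {w. {v, w} \<in> E}) (insert v A)"
        using v less.prems by (intro less.hyps psubset_card_mono) auto
      ultimately show ?thesis by simp
    qed
    then show ?thesis using False less.prems
      by (subst (1 2) greedy_run.simps) (simp, rule bind_pmf_cong, simp_all)
  qed
qed

definition size_prob :: "'a set set \<Rightarrow> 'a set \<Rightarrow> nat \<Rightarrow> real" where
  "size_prob E U k = pmf (map_pmf card (greedy_run E U {})) k"

lemma size_prob_empty: "size_prob E {} k = of_bool (k = 0)"
  by (simp add: size_prob_def greedy_run.simps[of E "{}"] indicator_def)

lemma size_prob_cong:
  assumes "finite U" and "\<And>u w. u \<in> U \<Longrightarrow> w \<in> U \<Longrightarrow> u \<noteq> w \<Longrightarrow> {u, w} \<in> E \<longleftrightarrow> {u, w} \<in> E'"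
  shows "size_prob E U k = size_prob E' U k"
  unfolding size_prob_def using greedy_run_edges_cong[OF assms] by simp

text \<open>
  The first chosen vertex contributes exactly \<open>1\<close> because the rest of the run never
  activates a vertex outside its undetermined set.
\<close>

lemma map_card_greedy_first_step:
  assumes "finite U" "U \<noteq> {}"
  shows "map_pmf card (greedy_run E U {})
    = pmf_of_set U \<bind> (\<lambda>v. map_pmf Suc (map_pmf card (greedy_run E (U - insert v {w. {v, w} \<in> E}) {})))"
proof -
  have "map_pmf card (greedy_run E (U - insert v {w. {v, w} \<in> E}) {v})
      = map_pmf Suc (map_pmf card (greedy_run E (U - insert v {w. {v, w} \<in> E}) {}))" if "v \<in> U" for v
  proof -
    let ?U = "U - insert v {w. {v, w} \<in> E}"
    have fin: "finite ?U" using assms by simp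
    have "map_pmf card (greedy_run E ?U {v}) = map_pmf (\<lambda>B. card (insert v B)) (greedy_run E ?U {})"
      by (subst greedy_run_active[OF fin]) (simp add: map_pmf_comp)
    also have "\<dots> = map_pmf (\<lambda>B. Suc (card B)) (greedy_run E ?U {})"
    proof (rule map_pmf_cong[OF refl])
      fix B assume "B \<in> set_pmf (greedy_run E ?U {})"
      from set_pmf_greedy_run(2)[OF fin this] have "B \<subseteq> ?U" by simp
      then have "finite B" "v \<notin> B" using fin finite_subset by auto
      then show "card (insert v B) = Suc (card B)" by simp
    qed
    finally show ?thesis by (simp add: map_pmf_comp)
  qed
  then show ?thesis using assms
    by (subst greedy_run.simps) (simp add: map_bind_pmf, rule bind_pmf_cong, simp_all)
qed

lemma size_prob_0:
  assumes "finite U" "U \<noteq> {}"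
  shows "size_prob E U 0 = 0"
proof -
  have "0 \<notin> set_pmf (map_pmf card (greedy_run E U {}))"
    unfolding map_card_greedy_first_step[OF assms] using assms by auto
  then show ?thesis unfolding size_prob_def by (simp only: set_pmf_iff not_not)
qed

lemma size_prob_Suc:
  assumes "finite U" "U \<noteq> {}"
  shows "size_prob E U (Suc k) = (\<Sum>v\<in>U. size_prob E (U - insert v {w. {v, w} \<in> E}) k) / card U"
  unfolding size_prob_def map_card_greedy_first_step[OF assms]
  using assms by (subst pmf_bind_pmf_of_set) (auto simp: pmf_map_inj')

section \<open>Rooted forests as parent maps\<close>

text \<open>
  The orbit of a vertex under \<open>f\<close> stays in \<open>U\<close> until it hits \<open>X\<close>.
\<close>

inductive reaches :: "'a set \<Rightarrow> ('a \<Rightarrow> 'a) \<Rightarrow> 'a set \<Rightarrow> 'a \<Rightarrow> bool"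
  for U f X where
  base: "x \<in> X \<Longrightarrow> reaches U f X x"
| step: "u \<in> U \<Longrightarrow> reaches U f X (f u) \<Longrightarrow> reaches U f X u"

text \<open>
  Forests on \<open>U\<close> in which every component is attached to one vertex of \<open>X\<close>, encoded by the map
  that sends a vertex to the next one on its way to \<open>X\<close>. Acyclicity is the condition that every
  vertex reaches \<open>X\<close>.
\<close>

definition parent_maps :: "'a set \<Rightarrow> 'a set \<Rightarrow> ('a \<Rightarrow> 'a) set" where
  "parent_maps X U = {f \<in> U \<rightarrow>\<^sub>E U \<union> X. \<forall>u\<in>U. reaches U f X u}"

definition parent_edges :: "'a set \<Rightarrow> ('a \<Rightarrow> 'a) \<Rightarrow> 'a set set" where
  "parent_edges U f = {{u, f u} | u. u \<in> U}"

lemma mem_parent_edges: "{u, w} \<in> parent_edges U f \<longleftrightarrow> u \<in> U \<and> f u = w \<or> w \<in> U \<and> f w = u"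
  by (auto simp: parent_edges_def doubleton_eq_iff)

lemma finite_parent_maps: "finite U \<Longrightarrow> finite X \<Longrightarrow> finite (parent_maps X U)"
  unfolding parent_maps_def by (rule finite_subset[of _ "U \<rightarrow>\<^sub>E U \<union> X"]) (auto intro: finite_PiE)

lemma parent_maps_empty: "parent_maps X {} = {\<lambda>_. undefined}"
  by (auto simp: parent_maps_def)

lemma reaches_relabel:
  assumes "reaches U f X u" and "\<And>u. u \<in> U \<Longrightarrow> \<tau> u = u"
    and "\<And>u. u \<in> U \<Longrightarrow> f' u = \<tau> (f u)"
  shows "reaches U f' (\<tau> ` X) (\<tau> u)"
  using assms(1)
proof induction
  case (base x)
  then show ?case by (intro reaches.base) auto
next
  case (step u)
  then show ?case using assms(2,3) by (metis reaches.step)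
qed

lemma reaches_mono:
  assumes "reaches U f X u" "U \<subseteq> U'" "X \<subseteq> X'" "\<And>u. u \<in> U \<Longrightarrow> f' u = f u"
  shows "reaches U' f' X' u"
  using assms(1)
proof induction
  case (base x)
  then show ?case using assms by (intro reaches.base) auto
next
  case (step u)
  then show ?case using assms by (metis reaches.step subsetD)
qed

lemma reaches_unique:
  assumes "reaches U f {b} u" "reaches U f {c} u" "b \<notin> U" "c \<notin> U"
  shows "b = c"
  using assms
proof (induction)
  case (base x)
  then show ?case by (auto elim: reaches.cases)
next
  case (step u)
  from step.prems(1) have "reaches U f {c} (f u)"
    using step by (auto elim: reaches.cases)
  then show ?case using step by blast
qed

lemma reaches_singletonE:
  assumes "reaches U f X u"
  obtains b where "b \<in> X" "reaches U f {b} u"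
  using assms
proof (induction arbitrary: thesis)
  case (base x)
  then show ?case by (auto intro: reaches.base)
next
  case (step u)
  then show ?case by (metis reaches.step)
qed

text \<open>
  The height is the number of steps to the target; its decrease along \<open>f\<close> is the form in which
  acyclicity is used.
\<close>

lemma reaches_height:
  assumes "\<And>u. u \<in> U \<Longrightarrow> reaches U f X u" "X \<inter> U = {}"
  obtains r :: "'a \<Rightarrow> nat" where "\<And>u. u \<in> U \<Longrightarrow> r (f u) < r u"
proof -
  define r where "r u = (LEAST n. (f ^^ n) u \<in> X)" for u
  have ex: "\<exists>n. (f ^^ n) u \<in> X" if "reaches U f X u" for u
    using that
  proof induction
    case (base x)
    then show ?case by (intro exI[of _ 0]) simp
  next
    case (step u)
    then obtain n where "(f ^^ n) (f u) \<in> X" by blast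
    then show ?case by (intro exI[of _ "Suc n"]) (simp add: funpow_swap1)
  qed
  have "r (f u) < r u" if u: "u \<in> U" for u
  proof -
    from ex[OF assms(1)[OF u]] have "(f ^^ r u) u \<in> X"
      unfolding r_def by (rule LeastI_ex)
    moreover from this u assms(2) obtain m where m: "r u = Suc m" by (cases "r u") auto
    ultimately have "(f ^^ m) (f u) \<in> X" by (simp add: funpow_swap1)
    then have "r (f u) \<le> m" unfolding r_def by (rule Least_le)
    then show ?thesis using m by simp
  qed
  then show ?thesis by (rule that)
qed

definition forest_sum :: "'a set \<Rightarrow> 'a set \<Rightarrow> nat \<Rightarrow> real" where
  "forest_sum X U k = (\<Sum>f\<in>parent_maps X U. size_prob (parent_edges U f) U k)"

text \<open>
  Interchanging two elements of \<open>X\<close> in the values of \<open>f\<close> preserves the graph induced on \<open>U\<close>, hence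
  the behaviour of the greedy procedure, and exchanges the sets of vertices hanging on these two
  elements. So all elements of \<open>X\<close> carry the same share of \<open>U\<close>.
\<close>

lemma forest_sum_reaching:
  assumes fin: "finite U" "finite X" and disj: "X \<inter> U = {}" and b: "b \<in> X"
  shows "real (card X) * (\<Sum>f\<in>parent_maps X U. size_prob (parent_edges U f) U k * real (card {u \<in> U. reaches U f {b} u}))
    = real (card U) * forest_sum X U k"
proof -
  define S where "S c = (\<Sum>f\<in>parent_maps X U. size_prob (parent_edges U f) U k * real (card {u \<in> U. reaches U f {c} u}))" for c
  have symmetric: "S c = S b" if c: "c \<in> X" for c
  proof -
    \<comment> \<open>Post-composition with this transposition maps parent maps to parent maps and is an involution.\<close>
    define \<tau> where "\<tau> = Transposition.transpose b c"
    have fix_U: "\<tau> u = u" if "u \<in> U" for u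
      using that b c disj unfolding \<tau>_def by (intro transpose_apply_other) auto
    have inv: "\<tau> (\<tau> x) = x" for x by (simp add: \<tau>_def)
    have img: "\<tau> ` X = X" using b c by (simp add: \<tau>_def)
    define \<Phi> where "\<Phi> f = restrict (\<tau> \<circ> f) U" for f
    have \<Phi>_mem: "\<Phi> f \<in> parent_maps X U" if f: "f \<in> parent_maps X U" for f
    proof -
      have "\<Phi> f \<in> U \<rightarrow>\<^sub>E U \<union> X"
        using f fix_U img unfolding \<Phi>_def parent_maps_def by (auto simp: PiE_iff) (metis UnE imageI)
      moreover have "reaches U (\<Phi> f) X u" if "u \<in> U" for u
        using reaches_relabel[of U f X u \<tau> "\<Phi> f"] f fix_U img that
        by (auto simp: parent_maps_def \<Phi>_def)
      ultimately show ?thesis by (auto simp: parent_maps_def)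
    qed
    have \<Phi>_inv: "\<Phi> (\<Phi> f) = f" if "f \<in> parent_maps X U" for f
      using that by (auto simp: \<Phi>_def parent_maps_def inv PiE_iff extensional_def fun_eq_iff)
    have edges: "size_prob (parent_edges U (\<Phi> f)) U k = size_prob (parent_edges U f) U k" if f: "f \<in> parent_maps X U" for f
    proof (rule size_prob_cong[OF fin(1)])
      fix u w assume uw: "u \<in> U" "w \<in> U" "u \<noteq> w"
      have "\<tau> (f x) = y \<longleftrightarrow> f x = y" if "x \<in> U" "y \<in> U" for x y
        using fix_U[OF that(2)] inv by metis
      then show "{u, w} \<in> parent_edges U (\<Phi> f) \<longleftrightarrow> {u, w} \<in> parent_edges U f"
        using uw by (auto simp: mem_parent_edges \<Phi>_def)
    qed
    have cards: "{u \<in> U. reaches U (\<Phi> f) {b} u} = {u \<in> U. reaches U f {c} u}" for f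
    proof -
      have "reaches U (\<Phi> f) {b} u \<longleftrightarrow> reaches U f {c} u" if u: "u \<in> U" for u
      proof
        assume "reaches U (\<Phi> f) {b} u"
        then have "reaches U f (\<tau> ` {b}) (\<tau> u)"
          by (rule reaches_relabel) (auto simp: fix_U \<Phi>_def inv)
        then show "reaches U f {c} u" using fix_U[OF u] by (simp add: \<tau>_def)
      next
        assume "reaches U f {c} u"
        then have "reaches U (\<Phi> f) (\<tau> ` {c}) (\<tau> u)"
          by (rule reaches_relabel) (auto simp: fix_U \<Phi>_def)
        then show "reaches U (\<Phi> f) {b} u" using fix_U[OF u] by (simp add: \<tau>_def)
      qed
      then show ?thesis by auto
    qed
    show ?thesis
      unfolding S_def
      by (rule sum.reindex_bij_witness[of _ \<Phi> \<Phi>])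
        (simp_all add: \<Phi>_mem \<Phi>_inv edges cards)
  qed
  have total: "(\<Sum>c\<in>X. card {u \<in> U. reaches U f {c} u}) = card U" if f: "f \<in> parent_maps X U" for f
  proof -
    have "(\<Sum>c\<in>X. card {u \<in> U. reaches U f {c} u}) = card (\<Union>c\<in>X. {u \<in> U. reaches U f {c} u})"
      using fin disj by (subst card_UN_disjoint) (auto dest: reaches_unique)
    also have "(\<Union>c\<in>X. {u \<in> U. reaches U f {c} u}) = U"
    proof (intro subset_antisym subsetI)
      fix u assume u: "u \<in> U"
      then have "reaches U f X u" using f by (simp add: parent_maps_def)
      then obtain c where "c \<in> X" "reaches U f {c} u" by (rule reaches_singletonE)
      then show "u \<in> (\<Union>c\<in>X. {u \<in> U. reaches U f {c} u})" using u by blast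
    qed auto
    finally show ?thesis .
  qed
  have "real (card X) * S b = (\<Sum>c\<in>X. S c)"
    using symmetric by simp
  also have "\<dots> = (\<Sum>f\<in>parent_maps X U. size_prob (parent_edges U f) U k * real (\<Sum>c\<in>X. card {u \<in> U. reaches U f {c} u}))"
    unfolding S_def by (subst sum.swap) (simp add: sum_distrib_left)
  also have "\<dots> = real (card U) * forest_sum X U k"
    unfolding forest_sum_def sum_distrib_left
    by (intro sum.cong) (simp_all only: total mult.commute)
  finally show ?thesis unfolding S_def .
qed

section \<open>Exposing the neighbourhood of the first active vertex\<close>

definition neighbours_in :: "'a set \<Rightarrow> ('a \<Rightarrow> 'a) \<Rightarrow> 'a \<Rightarrow> 'a set" where
  "neighbours_in U f v = {w \<in> U. f w = v \<or> f v = w}"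

text \<open>
  The two ways to put \<open>v\<close> and its neighbourhood \<open>D\<close> back on top of a parent map \<open>g\<close> of the
  remaining vertices: in the first, all of \<open>D\<close> are children of \<open>v\<close> and the parent of \<open>v\<close> is \<open>b\<close>; in the
  second, \<open>p \<in> D\<close> is the parent of \<open>v\<close> and has itself the parent \<open>q\<close>.
\<close>

definition graft_root :: "'a \<Rightarrow> 'a set \<Rightarrow> ('a \<Rightarrow> 'a) \<Rightarrow> 'a \<Rightarrow> 'a \<Rightarrow> 'a" where
  "graft_root v D g b = (\<lambda>u. if u = v then b else if u \<in> D then v else g u)"

definition graft_below :: "'a \<Rightarrow> 'a set \<Rightarrow> ('a \<Rightarrow> 'a) \<Rightarrow> 'a \<times> 'a \<Rightarrow> 'a \<Rightarrow> 'a" where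
  "graft_below v D g = (\<lambda>(p, q) u. if u = v then p else if u = p then q else if u \<in> D then v else g u)"

lemma parent_maps_height:
  assumes "f \<in> parent_maps X U" "X \<inter> U = {}"
  obtains r :: "'a \<Rightarrow> nat" where "\<And>u. u \<in> U \<Longrightarrow> r (f u) < r u"
proof (rule reaches_height[of U f X])
  show "reaches U f X u" if "u \<in> U" for u
    using assms(1) that by (simp add: parent_maps_def)
qed (use assms(2) in auto)

text \<open>
  An orbit that starts outside \<open>v\<close> can enter \<open>v\<close> only through a neighbour of \<open>v\<close>, where the orbit of
  the restriction stops.
\<close>

lemma restrict_parent_maps:
  assumes f: "f \<in> parent_maps X U" and "v \<in> U" and D: "D = neighbours_in U f v"
  defines "U' \<equiv> U - insert v D"
  shows "restrict f U' \<in> parent_maps (X \<union> D) U'"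
proof -
  have no_v: "f u \<noteq> v" if "u \<in> U'" for u
    using that unfolding U'_def D neighbours_in_def by auto
  have reach: "reaches U' (restrict f U') (X \<union> D) u" if "reaches U f X u" "u \<noteq> v" for u
    using that
  proof induction
    case (base x)
    then show ?case by (auto intro: reaches.base)
  next
    case (step u)
    show ?case
    proof (cases "u \<in> D")
      case True
      then show ?thesis by (auto intro: reaches.base)
    next
      case False
      then have u: "u \<in> U'" using step by (simp add: U'_def)
      then show ?thesis using step no_v[OF u] by (rule_tac reaches.step) auto
    qed
  qed
  have reach': "\<forall>u\<in>U'. reaches U' (restrict f U') (X \<union> D) u"
  proof
    fix u assume "u \<in> U'"
    then have "u \<in> U" "u \<noteq> v" by (simp_all add: U'_def)
    moreover from this f have "reaches U f X u" by (simp add: parent_maps_def)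
    ultimately show "reaches U' (restrict f U') (X \<union> D) u" by (intro reach)
  qed
  have "f u \<in> U' \<union> (X \<union> D)" if u: "u \<in> U'" for u
  proof -
    have "f u \<in> U \<union> X" using f u unfolding parent_maps_def U'_def by blast
    then show ?thesis using no_v[OF u] unfolding U'_def by blast
  qed
  then have "restrict f U' \<in> U' \<rightarrow>\<^sub>E U' \<union> (X \<union> D)" by (simp add: restrict_PiE_iff)
  with reach' show ?thesis by (simp add: parent_maps_def)
qed

text \<open>
  If the parent of \<open>v\<close> is some \<open>p\<close> in \<open>U\<close>, then the orbit of the parent \<open>q\<close> of \<open>p\<close> consists of
  vertices of smaller height than \<open>p\<close>, whereas \<open>v\<close> and the other neighbours of \<open>v\<close> have larger height.
  So this orbit avoids \<open>v\<close> and \<open>D\<close>, and \<open>q\<close> reaches \<open>X\<close> already under the restriction.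
\<close>

lemma graft_cases:
  assumes f: "f \<in> parent_maps X U" and disj: "X \<inter> U = {}" and v: "v \<in> U"
    and D: "D = neighbours_in U f v"
  defines "U' \<equiv> U - insert v D"
  defines "g \<equiv> restrict f U'"
  shows "f \<in> graft_root v D g ` X \<union> graft_below v D g ` (D \<times> {q \<in> X \<union> U'. reaches U' g X q})"
proof -
  obtain r :: "'a \<Rightarrow> nat" where r: "\<And>u. u \<in> U \<Longrightarrow> r (f u) < r u"
    by (rule parent_maps_height[OF f disj]) blast
  have range: "f u \<in> U \<union> X" if "u \<in> U" for u
    using f that by (auto simp: parent_maps_def)
  have undef: "f u = undefined" if "u \<notin> U" for u
    using f that by (auto simp: parent_maps_def PiE_iff extensional_def)
  show ?thesis
  proof (cases "f v \<in> X")
    case True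
    have "f = graft_root v D g (f v)"
      using True disj undef v
      by (auto simp: fun_eq_iff graft_root_def g_def U'_def D neighbours_in_def)
    then show ?thesis using True by blast
  next
    case False
    define p q where "p = f v" and "q = f p"
    have p: "p \<in> U" using False range[OF v] by (auto simp: p_def)
    then have pD: "p \<in> D" by (auto simp: D neighbours_in_def p_def)
    have rqp: "r q < r p" "r p < r v" using r p v by (auto simp: p_def q_def)
    have child: "f u = v" if "u \<in> D" "u \<noteq> p" for u
      using that by (auto simp: D neighbours_in_def p_def)
    have outside: "u \<noteq> v \<and> u \<notin> D" if "r u < r p" for u
    proof -
      have "r v < r u" if "u \<in> D" "u \<noteq> p" using r[of u] child[OF that] that by (auto simp: D neighbours_in_def)
      then show ?thesis using that rqp by fastforce
    qed
    have "reaches U' g X u" if "reaches U f X u" "r u < r p" for u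
      using that
    proof induction
      case (base x)
      then show ?case by (auto intro: reaches.base)
    next
      case (step u)
      then have u: "u \<in> U'" using outside[of u] by (auto simp: U'_def)
      have "r (f u) < r p" using r[of u] step by simp
      then show ?case using step u by (rule_tac reaches.step) (auto simp: g_def)
    qed
    moreover have "reaches U f X q"
      using f range[OF p] by (auto simp: q_def parent_maps_def intro: reaches.base)
    ultimately have "q \<in> {q \<in> X \<union> U'. reaches U' g X q}"
      using rqp outside[of q] range[OF p] by (auto simp: U'_def q_def)
    moreover have "f = graft_below v D g (p, q)"
    proof
      fix u
      show "f u = graft_below v D g (p, q) u"
        using undef[of u] child[of u] v p
        by (auto simp: graft_below_def g_def U'_def p_def q_def D neighbours_in_def)
    qed
    ultimately show ?thesis using pD by blast
  qed
qed

lemma graft_root_mem: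
  assumes disj: "X \<inter> U = {}" and v: "v \<in> U" and D: "D \<subseteq> U - {v}"
  defines "U' \<equiv> U - insert v D"
  assumes g: "g \<in> parent_maps (X \<union> D) U'" and b: "b \<in> X"
  defines "f \<equiv> graft_root v D g b"
  shows "f \<in> parent_maps X U" "neighbours_in U f v = D" "restrict f U' = g"
proof -
  have eq: "f u = g u" if "u \<in> U'" for u using that by (auto simp: f_def graft_root_def U'_def)
  have range: "g u \<in> U' \<union> X \<union> D" if "u \<in> U'" for u
    using g that by (auto simp: parent_maps_def)
  have undef: "g u = undefined" if "u \<notin> U'" for u
    using g that by (auto simp: parent_maps_def PiE_iff extensional_def)
  show "restrict f U' = g"
    using eq undef by (auto simp: fun_eq_iff)
  have "g u \<noteq> v" if "u \<in> U'" for u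
    using range[OF that] v disj D by (auto simp: U'_def)
  moreover have "b \<notin> U" using b disj by auto
  ultimately show "neighbours_in U f v = D"
    using D v eq by (auto simp: neighbours_in_def f_def graft_root_def U'_def)
  have reach_v: "reaches U f X v"
    using v b by (intro reaches.step[of v] reaches.base) (auto simp: f_def graft_root_def)
  have reach_D: "reaches U f X d" if "d \<in> D" for d
    using that D reach_v by (intro reaches.step[of d]) (auto simp: f_def graft_root_def)
  have "reaches U f X u" if "reaches U' g (X \<union> D) u" for u
    using that
  proof induction
    case (base x)
    then show ?case using reach_D by (auto intro: reaches.base)
  next
    case (step u)
    then show ?case using eq[of u] by (rule_tac reaches.step[of u]) (auto simp: U'_def)
  qed
  then have "\<forall>u\<in>U. reaches U f X u"
    using g reach_v reach_D by (auto simp: parent_maps_def U'_def)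
  moreover have "f u \<in> U \<union> X" if "u \<in> U" for u
    using that eq range[of u] b v D by (auto simp: f_def graft_root_def U'_def)
  moreover have "f u = undefined" if "u \<notin> U" for u
    using that undef[of u] D v by (auto simp: f_def graft_root_def U'_def)
  ultimately show "f \<in> parent_maps X U"
    by (auto simp: parent_maps_def PiE_iff extensional_def)
qed

text \<open>
  That \<open>q\<close> reaches \<open>X\<close> without passing through \<open>D\<close> is what keeps the new edge from \<open>p\<close> to \<open>q\<close> from
  closing a cycle.
\<close>

lemma graft_below_mem:
  assumes disj: "X \<inter> U = {}" and v: "v \<in> U" and D: "D \<subseteq> U - {v}"
  defines "U' \<equiv> U - insert v D"
  assumes g: "g \<in> parent_maps (X \<union> D) U'" and p: "p \<in> D" and q: "q \<in> X \<union> U'" "reaches U' g X q"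
  defines "f \<equiv> graft_below v D g (p, q)"
  shows "f \<in> parent_maps X U" "neighbours_in U f v = D" "restrict f U' = g"
proof -
  have eq: "f u = g u" if "u \<in> U'" for u using that p by (auto simp: f_def graft_below_def U'_def)
  have range: "g u \<in> U' \<union> X \<union> D" if "u \<in> U'" for u
    using g that by (auto simp: parent_maps_def)
  have undef: "g u = undefined" if "u \<notin> U'" for u
    using g that by (auto simp: parent_maps_def PiE_iff extensional_def)
  show "restrict f U' = g"
    using eq undef by (auto simp: fun_eq_iff)
  have "g u \<noteq> v" if "u \<in> U'" for u
    using range[OF that] v disj D by (auto simp: U'_def)
  moreover have "q \<noteq> v" using q v disj by (auto simp: U'_def)
  ultimately show "neighbours_in U f v = D"
    using D v p eq by (auto simp: neighbours_in_def f_def graft_below_def U'_def)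
  have "reaches U f X q"
    by (rule reaches_mono[OF q(2)]) (auto simp: U'_def eq)
  then have reach_p: "reaches U f X p"
    using p D by (intro reaches.step[of p]) (auto simp: f_def graft_below_def)
  then have reach_v: "reaches U f X v"
    using v by (intro reaches.step[of v]) (auto simp: f_def graft_below_def)
  have reach_D: "reaches U f X d" if "d \<in> D" for d
  proof (cases "d = p")
    case False
    then show ?thesis
      using that D reach_v by (intro reaches.step[of d]) (auto simp: f_def graft_below_def)
  qed (simp add: reach_p)
  have "reaches U f X u" if "reaches U' g (X \<union> D) u" for u
    using that
  proof induction
    case (base x)
    then show ?case using reach_D by (auto intro: reaches.base)
  next
    case (step u)
    then show ?case using eq[of u] by (rule_tac reaches.step[of u]) (auto simp: U'_def)
  qed
  then have "\<forall>u\<in>U. reaches U f X u"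
    using g reach_v reach_D by (auto simp: parent_maps_def U'_def)
  moreover have "f u \<in> U \<union> X" if "u \<in> U" for u
    using that eq range[of u] p q v D by (auto simp: f_def graft_below_def U'_def)
  moreover have "f u = undefined" if "u \<notin> U" for u
    using that undef[of u] D v p by (auto simp: f_def graft_below_def U'_def)
  ultimately show "f \<in> parent_maps X U"
    by (auto simp: parent_maps_def PiE_iff extensional_def)
qed

lemma card_graft_fibre:
  assumes fin: "finite U" "finite X" and disj: "X \<inter> U = {}" and v: "v \<in> U" and D: "D \<subseteq> U - {v}"
  defines "U' \<equiv> U - insert v D"
  assumes g: "g \<in> parent_maps (X \<union> D) U'"
  shows "card {f \<in> parent_maps X U. neighbours_in U f v = D \<and> restrict f U' = g}
     = card X + card D * card {q \<in> X \<union> U'. reaches U' g X q}"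
proof -
  let ?Q = "{q \<in> X \<union> U'. reaches U' g X q}"
  have "{f \<in> parent_maps X U. neighbours_in U f v = D \<and> restrict f U' = g}
      = graft_root v D g ` X \<union> graft_below v D g ` (D \<times> ?Q)"
  proof (intro subset_antisym subsetI)
    fix f assume f: "f \<in> {f \<in> parent_maps X U. neighbours_in U f v = D \<and> restrict f U' = g}"
    then have *: "f \<in> parent_maps X U" "D = neighbours_in U f v" "restrict f (U - insert v D) = g"
      by (auto simp: U'_def)
    show "f \<in> graft_root v D g ` X \<union> graft_below v D g ` (D \<times> ?Q)"
      using graft_cases[OF *(1) disj v *(2)] unfolding *(3) U'_def .
  next
    fix f assume "f \<in> graft_root v D g ` X \<union> graft_below v D g ` (D \<times> ?Q)"
    then consider b where "b \<in> X" "f = graft_root v D g b"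
      | p q where "p \<in> D" "q \<in> X \<union> U'" "reaches U' g X q" "f = graft_below v D g (p, q)"
      by blast
    then show "f \<in> {f \<in> parent_maps X U. neighbours_in U f v = D \<and> restrict f U' = g}"
    proof cases
      case 1
      then show ?thesis
        using graft_root_mem[OF disj v D g[unfolded U'_def] 1(1)] unfolding U'_def by simp
    next
      case 2
      then show ?thesis
        using graft_below_mem[OF disj v D g[unfolded U'_def] 2(1) 2(2,3)[unfolded U'_def]]
        unfolding U'_def by simp
    qed
  qed
  moreover have "graft_root v D g ` X \<inter> graft_below v D g ` (D \<times> ?Q) = {}"
  proof -
    have "graft_root v D g b \<noteq> graft_below v D g (p, q)" if "b \<in> X" "p \<in> D" for b p q
    proof
      assume "graft_root v D g b = graft_below v D g (p, q)"
      then have "graft_root v D g b v = graft_below v D g (p, q) v" by simp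
      then show False using that D disj by (auto simp: graft_root_def graft_below_def)
    qed
    then show ?thesis by auto
  qed
  moreover have "inj_on (graft_root v D g) X"
    by (rule inj_onI, drule fun_cong[of _ _ v]) (simp add: graft_root_def)
  moreover have "inj_on (graft_below v D g) (D \<times> ?Q)"
  proof (rule inj_onI)
    fix x y assume xy: "x \<in> D \<times> ?Q" "y \<in> D \<times> ?Q" "graft_below v D g x = graft_below v D g y"
    obtain p q p' q' where x: "x = (p, q)" and y: "y = (p', q')" by fastforce
    from xy have "p \<noteq> v" using D by (auto simp: x)
    moreover from xy(3) have "graft_below v D g x v = graft_below v D g y v"
      "graft_below v D g x p = graft_below v D g y p" by auto
    ultimately show "x = y" by (auto simp: x y graft_below_def)
  qed
  moreover have "finite D" "finite ?Q" using fin D finite_subset by (auto simp: U'_def)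
  ultimately show ?thesis
    using fin by (simp add: card_Un_disjoint card_image card_cartesian_product)
qed

lemma sum_by_neighbours:
  fixes h :: "('a \<Rightarrow> 'a) \<Rightarrow> real"
  assumes fin: "finite U" "finite X" and disj: "X \<inter> U = {}" and v: "v \<in> U" and D: "D \<subseteq> U - {v}"
  defines "U' \<equiv> U - insert v D"
  shows "(\<Sum>f\<in>{f \<in> parent_maps X U. neighbours_in U f v = D}. h (restrict f U'))
     = (\<Sum>g\<in>parent_maps (X \<union> D) U'. (card X + card D * card {q \<in> X \<union> U'. reaches U' g X q}) * h g)"
proof -
  let ?F = "{f \<in> parent_maps X U. neighbours_in U f v = D}"
  have finD: "finite D" "finite U'" using fin D finite_subset by (auto simp: U'_def)
  have "(\<Sum>f\<in>?F. h (restrict f U'))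
      = (\<Sum>g\<in>parent_maps (X \<union> D) U'. \<Sum>f\<in>{f \<in> ?F. restrict f U' = g}. h (restrict f U'))"
    using fin finD v restrict_parent_maps[OF _ v]
    by (intro sum.group[symmetric]) (auto simp: finite_parent_maps U'_def)
  also have "\<dots> = (\<Sum>g\<in>parent_maps (X \<union> D) U'. (card X + card D * card {q \<in> X \<union> U'. reaches U' g X q}) * h g)"
  proof (rule sum.cong[OF refl])
    fix g assume g: "g \<in> parent_maps (X \<union> D) U'"
    have "(\<Sum>f\<in>{f \<in> ?F. restrict f U' = g}. h (restrict f U')) = card {f \<in> ?F. restrict f U' = g} * h g"
      by simp
    then show "(\<Sum>f\<in>{f \<in> ?F. restrict f U' = g}. h (restrict f U'))
      = (card X + card D * card {q \<in> X \<union> U'. reaches U' g X q}) * h g"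
      using card_graft_fibre[OF fin disj v D g[unfolded U'_def]]
      by (simp add: U'_def conj_assoc)
  qed
  finally show ?thesis .
qed

text \<open>
  The fibre sizes are averaged by symmetry: among the vertices of \<open>U'\<close>, the share that hangs on
  \<open>X\<close> rather than on \<open>D\<close> is \<open>|X| / |X \<union> D|\<close>.
\<close>

lemma forest_sum_fixed_first:
  assumes fin: "finite U" "finite X" and disj: "X \<inter> U = {}" and v: "v \<in> U" and D: "D \<subseteq> U - {v}"
    and X: "X \<noteq> {}"
  defines "U' \<equiv> U - insert v D"
  shows "(\<Sum>f\<in>{f \<in> parent_maps X U. neighbours_in U f v = D}. size_prob (parent_edges U f) U' k)
     = card X * (1 + card D * (real (card X) + real (card U) - 1) / (real (card X) + card D)) * forest_sum (X \<union> D) U' k"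
proof -
  let ?S = "\<lambda>g. size_prob (parent_edges U' g) U' k"
  have finD: "finite D" "finite U'" using fin D finite_subset by (auto simp: U'_def)
  have XD: "X \<inter> D = {}" "(X \<union> D) \<inter> U' = {}" using disj D by (auto simp: U'_def)
  define x d m where "x = real (card X)" and "d = real (card D)" and "m = real (card U')"
  have x: "x > 0" using X fin by (simp add: x_def card_gt_0_iff)
  have d: "d \<ge> 0" by (simp add: d_def)
  have "card U = Suc (card D) + card U'"
  proof -
    have "insert v D \<union> U' = U" "insert v D \<inter> U' = {}" using v D by (auto simp: U'_def)
    then have "card U = card (insert v D) + card U'" using finD card_Un_disjoint[of "insert v D" U'] by simp
    moreover have "v \<notin> D" using D by auto
    ultimately show ?thesis using finD by simp
  qed
  then have U: "real (card U) = 1 + d + m" by (simp add: d_def m_def)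
  have "(\<Sum>f\<in>{f \<in> parent_maps X U. neighbours_in U f v = D}. size_prob (parent_edges U f) U' k)
      = (\<Sum>f\<in>{f \<in> parent_maps X U. neighbours_in U f v = D}. ?S (restrict f U'))"
    by (intro sum.cong refl size_prob_cong finD) (auto simp: mem_parent_edges U'_def)
  also have "\<dots> = (\<Sum>g\<in>parent_maps (X \<union> D) U'. (card X + card D * card {q \<in> X \<union> U'. reaches U' g X q}) * ?S g)"
    unfolding U'_def by (rule sum_by_neighbours[OF fin disj v D])
  also have "\<dots> = (\<Sum>g\<in>parent_maps (X \<union> D) U'. (x + d * x) * ?S g
      + d * (\<Sum>b\<in>X. ?S g * card {u \<in> U'. reaches U' g {b} u}))"
  proof (rule sum.cong[OF refl])
    fix g
    have "{q \<in> X \<union> U'. reaches U' g X q} = X \<union> (\<Union>b\<in>X. {u \<in> U'. reaches U' g {b} u})"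
    proof (intro subset_antisym subsetI)
      fix q assume "q \<in> {q \<in> X \<union> U'. reaches U' g X q}"
      then have q: "q \<in> X \<union> U'" "reaches U' g X q" by auto
      from q(2) obtain b where "b \<in> X" "reaches U' g {b} q" by (rule reaches_singletonE)
      then show "q \<in> X \<union> (\<Union>b\<in>X. {u \<in> U'. reaches U' g {b} u})" using q(1) by blast
    next
      fix q assume "q \<in> X \<union> (\<Union>b\<in>X. {u \<in> U'. reaches U' g {b} u})"
      then consider "q \<in> X" | b where "b \<in> X" "q \<in> U'" "reaches U' g {b} q" by blast
      then show "q \<in> {q \<in> X \<union> U'. reaches U' g X q}"
      proof cases
        case 1
        then show ?thesis by (simp add: reaches.base)
      next
        case 2
        have "reaches U' g X q" by (rule reaches_mono[OF 2(3)]) (use 2 in auto)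
        then show ?thesis using 2 by simp
      qed
    qed
    also have "card \<dots> = card X + card (\<Union>b\<in>X. {u \<in> U'. reaches U' g {b} u})"
      using fin finD XD by (intro card_Un_disjoint) auto
    \<comment> \<open>Each vertex reaches at most one element of the target set.\<close>
    also have "card (\<Union>b\<in>X. {u \<in> U'. reaches U' g {b} u}) = (\<Sum>b\<in>X. card {u \<in> U'. reaches U' g {b} u})"
      using fin finD XD by (intro card_UN_disjoint) (auto dest: reaches_unique)
    finally show "(card X + card D * card {q \<in> X \<union> U'. reaches U' g X q}) * ?S g
      = (x + d * x) * ?S g + d * (\<Sum>b\<in>X. ?S g * card {u \<in> U'. reaches U' g {b} u})"
      by (simp add: x_def d_def algebra_simps sum_distrib_left sum_distrib_right)
  qed
  also have "\<dots> = (x + d * x) * forest_sum (X \<union> D) U' k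
      + d * (\<Sum>g\<in>parent_maps (X \<union> D) U'. \<Sum>b\<in>X. ?S g * card {u \<in> U'. reaches U' g {b} u})"
    unfolding sum.distrib forest_sum_def sum_distrib_left ..
  also have "(\<Sum>g\<in>parent_maps (X \<union> D) U'. \<Sum>b\<in>X. ?S g * card {u \<in> U'. reaches U' g {b} u})
      = (\<Sum>b\<in>X. \<Sum>g\<in>parent_maps (X \<union> D) U'. ?S g * card {u \<in> U'. reaches U' g {b} u})"
    by (rule sum.swap)
  also have "(\<Sum>b\<in>X. \<Sum>g\<in>parent_maps (X \<union> D) U'. ?S g * card {u \<in> U'. reaches U' g {b} u})
      = (\<Sum>b\<in>X. m * forest_sum (X \<union> D) U' k / (x + d))"
  proof (rule sum.cong[OF refl])
    fix b assume b: "b \<in> X"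
    have "real (card (X \<union> D)) = x + d"
      using fin finD XD by (simp add: card_Un_disjoint x_def d_def)
    then show "(\<Sum>g\<in>parent_maps (X \<union> D) U'. ?S g * card {u \<in> U'. reaches U' g {b} u}) = m * forest_sum (X \<union> D) U' k / (x + d)"
      using forest_sum_reaching[of U' "X \<union> D" b k] fin finD XD b x d by (simp add: m_def field_simps)
  qed
  also have "(x + d * x) * forest_sum (X \<union> D) U' k + d * (\<Sum>b\<in>X. m * forest_sum (X \<union> D) U' k / (x + d))
      = x * (1 + d * (x + (1 + d + m) - 1) / (x + d)) * forest_sum (X \<union> D) U' k"
    using x d by (simp add: x_def[symmetric] divide_simps) (simp add: algebra_simps)
  finally show ?thesis unfolding x_def[symmetric] d_def[symmetric] U .
qed

text \<open>
  The recursion that determines all forest sums: the first active vertex \<open>v\<close> and its set \<open>D\<close> of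
  newly blocked vertices leave a state of the same kind.
\<close>

lemma forest_sum_Suc:
  assumes fin: "finite U" "finite X" and disj: "X \<inter> U = {}" and U: "U \<noteq> {}" and X: "X \<noteq> {}"
  shows "forest_sum X U (Suc k) = (\<Sum>v\<in>U. \<Sum>D\<in>Pow (U - {v}).
     card X * (1 + card D * (real (card X) + real (card U) - 1) / (real (card X) + card D))
       * forest_sum (X \<union> D) (U - insert v D) k) / card U"
proof -
  have "forest_sum X U (Suc k)
      = (\<Sum>f\<in>parent_maps X U. \<Sum>v\<in>U. size_prob (parent_edges U f) (U - insert v (neighbours_in U f v)) k) / card U"
    unfolding forest_sum_def size_prob_Suc[OF fin(1) U] sum_divide_distrib[symmetric]
  proof (intro arg_cong2[where f = "(/)"] sum.cong refl)
    fix f v assume "v \<in> U"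
    then have "U - insert v {w. {v, w} \<in> parent_edges U f} = U - insert v (neighbours_in U f v)"
      by (auto simp: mem_parent_edges neighbours_in_def)
    then show "size_prob (parent_edges U f) (U - insert v {w. {v, w} \<in> parent_edges U f}) k
      = size_prob (parent_edges U f) (U - insert v (neighbours_in U f v)) k" by simp
  qed
  also have "(\<Sum>f\<in>parent_maps X U. \<Sum>v\<in>U. size_prob (parent_edges U f) (U - insert v (neighbours_in U f v)) k)
    = (\<Sum>v\<in>U. \<Sum>f\<in>parent_maps X U. size_prob (parent_edges U f) (U - insert v (neighbours_in U f v)) k)"
    by (rule sum.swap)
  also have "\<dots> = (\<Sum>v\<in>U. \<Sum>D\<in>Pow (U - {v}).
     card X * (1 + card D * (real (card X) + real (card U) - 1) / (real (card X) + card D))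
       * forest_sum (X \<union> D) (U - insert v D) k)"
  proof (rule sum.cong[OF refl])
    fix v assume v: "v \<in> U"
    have nb: "neighbours_in U f v \<in> Pow (U - {v})" if f: "f \<in> parent_maps X U" for f
    proof -
      obtain r :: "'a \<Rightarrow> nat" where r: "\<And>u. u \<in> U \<Longrightarrow> r (f u) < r u"
        by (rule parent_maps_height[OF f disj]) blast
      show ?thesis using r[OF v] by (auto simp: neighbours_in_def)
    qed
    have "(\<Sum>f\<in>parent_maps X U. size_prob (parent_edges U f) (U - insert v (neighbours_in U f v)) k)
      = (\<Sum>D\<in>Pow (U - {v}). \<Sum>f\<in>{f \<in> parent_maps X U. neighbours_in U f v = D}.
            size_prob (parent_edges U f) (U - insert v (neighbours_in U f v)) k)"
      using fin nb by (intro sum.group[symmetric]) (auto simp: finite_parent_maps)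
    also have "\<dots> = (\<Sum>D\<in>Pow (U - {v}).
     card X * (1 + card D * (real (card X) + real (card U) - 1) / (real (card X) + card D))
       * forest_sum (X \<union> D) (U - insert v D) k)"
    proof (rule sum.cong[OF refl])
      fix D assume "D \<in> Pow (U - {v})"
      then have D: "D \<subseteq> U - {v}" by simp
      show "(\<Sum>f\<in>{f \<in> parent_maps X U. neighbours_in U f v = D}.
            size_prob (parent_edges U f) (U - insert v (neighbours_in U f v)) k) =
        card X * (1 + card D * (real (card X) + real (card U) - 1) / (real (card X) + card D))
       * forest_sum (X \<union> D) (U - insert v D) k"
        unfolding forest_sum_fixed_first[OF fin disj v D X, symmetric]
        by (intro sum.cong) auto
    qed
    finally show "(\<Sum>f\<in>parent_maps X U. size_prob (parent_edges U f) (U - insert v (neighbours_in U f v)) k)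
      = (\<Sum>D\<in>Pow (U - {v}).
     card X * (1 + card D * (real (card X) + real (card U) - 1) / (real (card X) + card D))
       * forest_sum (X \<union> D) (U - insert v D) k)" .
  qed
  finally show ?thesis .
qed

section \<open>Closed form of the forest sums\<close>

text \<open>
  The number of rooted Cayley trees of size \<open>n\<close> with exactly \<open>k\<close> vertices at even height.
\<close>

definition even_height_weight :: "nat \<Rightarrow> nat \<Rightarrow> real" where
  "even_height_weight n k = real (n choose k) * real k ^ (n - k) * real (n - k) ^ (k - 1)"

text \<open>
  The closed form of \<open>forest_sum X U k\<close> in terms of \<open>x = |X|\<close> and \<open>m = |U|\<close>. For each of
  the \<open>m choose k\<close> sets of \<open>k\<close> vertices, the other factors count the forests, rooted at \<open>X\<close>, of which
  every edge joins this set to the remaining \<open>x + m - k\<close> vertices. For \<open>m = k = 0\<close> the true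
  exponent \<open>k - 1 = -1\<close> would give \<open>1\<close>, whereas the truncated one gives \<open>x\<close>; hence the separate case.
\<close>

definition forest_weight :: "real \<Rightarrow> nat \<Rightarrow> nat \<Rightarrow> real" where
  "forest_weight x m k = (if m = 0 then of_bool (k = 0)
     else real (m choose k) * x * (x + real m - real k) ^ (k - 1) * real k ^ (m - k))"

lemma sum_Pow_card:
  fixes c :: "nat \<Rightarrow> real"
  assumes "finite A"
  shows "(\<Sum>D\<in>Pow A. c (card D)) = (\<Sum>d\<le>card A. real (card A choose d) * c d)"
proof -
  have "(\<Sum>D\<in>Pow A. c (card D)) = (\<Sum>d\<le>card A. \<Sum>D\<in>{D \<in> Pow A. card D = d}. c (card D))"
    using assms by (intro sum.group[symmetric]) (auto intro: card_mono)
  also have "\<dots> = (\<Sum>d\<le>card A. real (card A choose d) * c d)"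
    using n_subsets[OF assms] by (intro sum.cong) simp_all
  finally show ?thesis .
qed

lemma binomial_linear_sum:
  fixes \<alpha> \<beta> y :: real
  shows "(\<Sum>d\<le>r. real (r choose d) * y ^ (r - d) * (\<alpha> + \<beta> * d)) = \<alpha> * (1 + y) ^ r + \<beta> * r * (1 + y) ^ (r - 1)"
proof -
  have binom: "(\<Sum>d\<le>s. real (s choose d) * y ^ (s - d)) = (1 + y) ^ s" for s
    using binomial_ring[of 1 y s] by simp
  have "(\<Sum>d\<le>r. real (r choose d) * y ^ (r - d) * d) = r * (1 + y) ^ (r - 1)"
  proof (cases r)
    case (Suc s)
    have "(\<Sum>d\<le>r. real (r choose d) * y ^ (r - d) * d) = (\<Sum>d\<le>s. real (Suc d * (r choose Suc d)) * y ^ (s - d))"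
      unfolding Suc by (subst sum.atMost_Suc_shift) (simp add: mult_ac del: binomial_Suc_Suc of_nat_Suc mult_Suc mult_Suc_right)
    also have "\<dots> = r * (\<Sum>d\<le>s. real (s choose d) * y ^ (s - d))"
      unfolding sum_distrib_left Suc Suc_times_binomial by (simp add: mult_ac del: of_nat_Suc mult_Suc mult_Suc_right)
    finally show ?thesis using binom[of s] Suc by simp
  qed simp
  then show ?thesis
    using binom[of r] by (simp add: algebra_simps sum.distrib flip: sum_distrib_left)
qed

lemma forest_weight_term:
  assumes "d \<le> M"
  shows "real (M choose d) * forest_weight (x + d) (M - d) (Suc j)
    = real (M choose Suc j) * (x + real M - real (Suc j)) ^ j
      * (real (M - Suc j choose d) * real (Suc j) ^ (M - Suc j - d) * (x + d))"
proof (cases "Suc j \<le> M - d")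
  case True
  then have "d \<le> M - Suc j" "Suc j \<le> M" using assms by auto
  then have "(M choose d) * (M - d choose Suc j) = (M choose Suc j) * (M - Suc j choose d)"
    using choose_mult[of d "d + Suc j" M] choose_mult[of "Suc j" "d + Suc j" M] True assms
      binomial_symmetric[of d "d + Suc j"] by simp
  then have "real (M choose d) * real (M - d choose Suc j) = real (M choose Suc j) * real (M - Suc j choose d)"
    by (metis of_nat_mult)
  moreover have "M - d - Suc j = M - Suc j - d" by simp
  moreover have "x + real d + real (M - d) - real (Suc j) = x + real M - real (Suc j)"
    using assms by (simp add: of_nat_diff)
  moreover have "d < M" using True assms by simp
  ultimately show ?thesis
    using True by (simp add: forest_weight_def mult_ac del: binomial_Suc_Suc of_nat_Suc)
next
  case False
  then have "M - d choose Suc j = 0" by (simp del: binomial_Suc_Suc)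
  moreover have "M choose Suc j = 0 \<or> M - Suc j choose d = 0"
    using False assms by (cases "Suc j \<le> M") (auto simp: binomial_eq_0_iff simp del: binomial_Suc_Suc)
  moreover from \<open>M - d choose Suc j = 0\<close> have "forest_weight (x + d) (M - d) (Suc j) = 0"
    unfolding forest_weight_def by (simp del: binomial_eq_0_iff binomial_Suc_Suc)
  ultimately show ?thesis by (auto simp del: binomial_eq_0_iff binomial_Suc_Suc)
qed

lemma forest_weight_zero: "forest_weight x m 0 = of_bool (m = 0)"
  by (simp add: forest_weight_def)

text \<open>
  In every sum that occurs, the coefficient \<open>h\<close> times the factor \<open>x + d\<close> of the weight is affine in
  \<open>d\<close>, so that only the binomial theorem and its first derivative are needed.
\<close>

lemma sum_forest_weight_terms:
  fixes \<alpha> \<beta> x :: real and h :: "nat \<Rightarrow> real"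
  assumes h: "\<And>d. h d * (x + d) = \<alpha> + \<beta> * d"
  shows "(\<Sum>d\<le>M. real (M choose d) * (h d * forest_weight (x + d) (M - d) (Suc j)))
    = real (M choose Suc j) * (x + real M - real (Suc j)) ^ j
      * (\<alpha> * real (Suc (Suc j)) ^ (M - Suc j) + \<beta> * (M - Suc j) * real (Suc (Suc j)) ^ (M - Suc j - 1))"
proof -
  let ?c = "real (M choose Suc j) * (x + real M - real (Suc j)) ^ j"
  have "(\<Sum>d\<le>M. real (M choose d) * (h d * forest_weight (x + d) (M - d) (Suc j)))
      = (\<Sum>d\<le>M. ?c * (real (M - Suc j choose d) * real (Suc j) ^ (M - Suc j - d) * (\<alpha> + \<beta> * d)))"
  proof (rule sum.cong[OF refl])
    fix d assume "d \<in> {..M}"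
    then have "real (M choose d) * (h d * forest_weight (x + d) (M - d) (Suc j))
      = h d * (?c * (real (M - Suc j choose d) * real (Suc j) ^ (M - Suc j - d) * (x + d)))"
      using forest_weight_term[of d M x j] by (simp add: mult.left_commute)
    also have "\<dots> = ?c * (real (M - Suc j choose d) * real (Suc j) ^ (M - Suc j - d) * (h d * (x + d)))"
      by (simp only: mult_ac)
    finally show "real (M choose d) * (h d * forest_weight (x + d) (M - d) (Suc j))
      = ?c * (real (M - Suc j choose d) * real (Suc j) ^ (M - Suc j - d) * (\<alpha> + \<beta> * d))"
      unfolding h .
  qed
  also have "\<dots> = (\<Sum>d\<le>M - Suc j. ?c * (real (M - Suc j choose d) * real (Suc j) ^ (M - Suc j - d) * (\<alpha> + \<beta> * d)))"
    by (rule sum.mono_neutral_right) auto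
  also have "\<dots> = ?c * (\<alpha> * real (Suc (Suc j)) ^ (M - Suc j) + \<beta> * (M - Suc j) * real (Suc (Suc j)) ^ (M - Suc j - 1))"
    unfolding sum_distrib_left[symmetric] binomial_linear_sum by simp
  finally show ?thesis .
qed

text \<open>
  The right-hand side of the recursion \<open>forest_sum_Suc\<close>, after summation over the sets \<open>D\<close> of equal
  size.
\<close>

lemma forest_weight_rec:
  assumes x: "x > 0"
  shows "(\<Sum>d\<le>M. real (M choose d) * (x * (1 + d * (x + M) / (x + d)) * forest_weight (x + d) (M - d) k))
      = forest_weight x (Suc M) (Suc k)"
proof (cases k)
  case 0
  have "(\<Sum>d\<le>M. real (M choose d) * (x * (1 + d * (x + M) / (x + d)) * forest_weight (x + d) (M - d) k))
    = (\<Sum>d\<in>{M}. real (M choose d) * (x * (1 + d * (x + M) / (x + d)) * forest_weight (x + d) (M - d) k))"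
    unfolding 0 forest_weight_zero by (rule sum.mono_neutral_right) auto
  also have "\<dots> = forest_weight x (Suc M) (Suc k)"
    using x by (simp add: 0 forest_weight_def field_simps)
  finally show ?thesis .
next
  case (Suc j)
  have h: "x * (1 + d * (x + M) / (x + d)) * (x + d) = x * x + x * (1 + x + M) * d" for d :: nat
    using x by (simp add: field_simps)
  have rhs: "forest_weight x (Suc M) (Suc k)
      = real (Suc M choose Suc k) * x * (x + real M - real k) ^ k * real (Suc k) ^ (M - k)"
    by (simp add: forest_weight_def add_diff_eq del: binomial_Suc_Suc)
  show ?thesis
  proof (cases "k \<le> M")
    case False
    then have "M choose Suc j = 0" "Suc M choose Suc (Suc j) = 0"
      unfolding Suc by (auto simp: binomial_eq_0 simp del: binomial_Suc_Suc)
    then show ?thesis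
      using sum_forest_weight_terms[OF h, of M j] unfolding rhs unfolding Suc
      by (simp del: binomial_eq_0_iff binomial_Suc_Suc)
  next
    case True
    then obtain r where M: "M = k + r" using le_Suc_ex by blast
    have C: "real (Suc M choose Suc k) = real (Suc M) * real (M choose k) / real (Suc k)"
    proof -
      have "real (Suc k) * real (Suc M choose Suc k) = real (Suc M) * real (M choose k)"
        by (metis Suc_times_binomial of_nat_mult)
      then show ?thesis by (simp add: field_simps del: binomial_Suc_Suc)
    qed
    have key: "real (Suc M) / real (Suc k) * (x + r) * real (Suc k) ^ r
        = x * real (Suc k) ^ r + (1 + x + M) * r * real (Suc k) ^ (r - 1)"
      by (cases r) (simp_all add: M field_simps)
    have "(\<Sum>d\<le>M. real (M choose d) * (x * (1 + d * (x + M) / (x + d)) * forest_weight (x + d) (M - d) k))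
        = real (M choose k) * (x + r) ^ j * (x * (x * real (Suc k) ^ r + (1 + x + M) * r * real (Suc k) ^ (r - 1)))"
      using sum_forest_weight_terms[OF h, of M j] unfolding Suc[symmetric]
      by (simp add: M mult_ac ring_distribs)
    also have "\<dots> = forest_weight x (Suc M) (Suc k)"
      unfolding key[symmetric] rhs C by (simp add: M Suc mult_ac del: binomial_Suc_Suc)
    finally show ?thesis .
  qed
qed

text \<open>
  The first step of the greedy procedure on a tree: after the first vertex is chosen, its \<open>d\<close>
  neighbours are the only blocked vertices.
\<close>

lemma forest_weight_first_step:
  "(\<Sum>d\<le>M. real (M choose d) * forest_weight d (M - d) k) = even_height_weight (Suc M) (Suc k) / real (Suc M)"
proof -
  have C: "real (Suc M choose Suc k) = real (Suc M) * real (M choose k) / real (Suc k)"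
  proof -
    have "real (Suc k) * real (Suc M choose Suc k) = real (Suc M) * real (M choose k)"
      by (metis Suc_times_binomial of_nat_mult)
    then show ?thesis by (simp add: field_simps del: binomial_Suc_Suc)
  qed
  have rhs: "even_height_weight (Suc M) (Suc k) / real (Suc M)
      = real (M choose k) * real (Suc k) ^ (M - k) / real (Suc k) * real (M - k) ^ k"
    unfolding even_height_weight_def C by (simp del: of_nat_Suc)
  show ?thesis
  proof (cases k)
    case 0
    have "(\<Sum>d\<le>M. real (M choose d) * forest_weight d (M - d) k)
      = (\<Sum>d\<in>{M}. real (M choose d) * forest_weight d (M - d) k)"
      unfolding 0 forest_weight_zero by (rule sum.mono_neutral_right) auto
    then show ?thesis unfolding rhs by (simp add: 0 forest_weight_def)
  next
    case (Suc j)
    have "(\<Sum>d\<le>M. real (M choose d) * forest_weight d (M - d) k)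
      = real (M choose k) * (real M - real k) ^ j * (real (M - k) * real (Suc k) ^ (M - k - 1))"
      using sum_forest_weight_terms[of "\<lambda>_. 1" 0 0 1 M j] by (simp add: Suc)
    also have "\<dots> = even_height_weight (Suc M) (Suc k) / real (Suc M)"
    proof (cases "k \<le> M")
      case True
      then obtain r where M: "M = k + r" using le_Suc_ex by blast
      show ?thesis unfolding rhs
        by (cases r) (simp_all add: M Suc field_simps)
    qed (unfold rhs, simp)
    finally show ?thesis .
  qed
qed

theorem forest_sum_eq_weight:
  assumes "finite U" "finite X" "X \<inter> U = {}"
  shows "forest_sum X U k = forest_weight (card X) (card U) k"
  using assms
proof (induction k arbitrary: X U)
  case 0
  then show ?case
    by (cases "U = {}") (simp_all add: forest_sum_def size_prob_0 size_prob_empty parent_maps_empty forest_weight_zero)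
next
  case (Suc k)
  note fin = Suc.prems(1,2) and disj = Suc.prems(3)
  consider "U = {}" | "U \<noteq> {}" "X = {}" | "U \<noteq> {}" "X \<noteq> {}" by blast
  then show ?case
  proof cases
    case 1
    then show ?thesis by (simp add: forest_sum_def size_prob_empty parent_maps_empty forest_weight_def)
  next
    case 2
    have "\<not> reaches U f {} u" for f u
    proof
      assume "reaches U f {} u"
      then show False by induction auto
    qed
    then have "parent_maps X U = {}" using 2 by (auto simp: parent_maps_def)
    then show ?thesis using 2 fin by (simp add: forest_sum_def forest_weight_def)
  next
    case 3
    obtain M where M: "card U = Suc M" using 3 fin by (cases "card U") auto
    define x where "x = real (card X)"
    have x: "x > 0" using 3 fin by (simp add: x_def card_gt_0_iff)
    have "forest_sum X U (Suc k) = (\<Sum>v\<in>U. forest_weight x (Suc M) (Suc k)) / card U"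
      unfolding forest_sum_Suc[OF fin disj 3]
    proof (intro arg_cong2[where f = "(/)"] sum.cong refl)
      fix v assume v: "v \<in> U"
      have fin': "finite (U - {v})" and card': "card (U - {v}) = M" using fin v M by auto
      have "(\<Sum>D\<in>Pow (U - {v}). card X * (1 + card D * (real (card X) + real (card U) - 1) / (real (card X) + card D))
          * forest_sum (X \<union> D) (U - insert v D) k)
        = (\<Sum>D\<in>Pow (U - {v}). x * (1 + card D * (x + M) / (x + card D)) * forest_weight (x + card D) (M - card D) k)"
      proof (rule sum.cong[OF refl])
        fix D assume "D \<in> Pow (U - {v})"
        then have D: "D \<subseteq> U - {v}" by simp
        then have finD: "finite D" using fin finite_subset by blast
        have "forest_sum (X \<union> D) (U - insert v D) k = forest_weight (card (X \<union> D)) (card (U - insert v D)) k"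
          using fin finD disj D by (intro Suc.IH) auto
        also have "card (X \<union> D) = card X + card D"
          using fin finD disj D by (intro card_Un_disjoint) auto
        also have "card (U - insert v D) = M - card D"
        proof -
          have "U - insert v D = (U - {v}) - D" by auto
          then show ?thesis using card_Diff_subset[OF finD D] card' by simp
        qed
        finally show "card X * (1 + card D * (real (card X) + real (card U) - 1) / (real (card X) + card D))
          * forest_sum (X \<union> D) (U - insert v D) k
          = x * (1 + card D * (x + M) / (x + card D)) * forest_weight (x + card D) (M - card D) k"
          by (simp add: x_def M)
      qed
      also have "\<dots> = forest_weight x (Suc M) (Suc k)"
        by (subst sum_Pow_card[OF fin', of "\<lambda>d. x * (1 + d * (x + M) / (x + d)) * forest_weight (x + d) (M - d) k"])
          (simp only: card' forest_weight_rec[OF x])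
      finally show "(\<Sum>D\<in>Pow (U - {v}). card X * (1 + card D * (real (card X) + real (card U) - 1) / (real (card X) + card D))
          * forest_sum (X \<union> D) (U - insert v D) k) = forest_weight x (Suc M) (Suc k)" .
    qed
    then show ?thesis using M by (simp add: x_def)
  qed
qed

section \<open>Cayley trees as parent maps\<close>

lemma rtranclp_shortest_path:
  assumes "R\<^sup>*\<^sup>* a b"
  obtains xs where "xs \<noteq> []" "hd xs = a" "last xs = b" "distinct xs" "successively R xs"
proof -
  have "\<exists>xs. xs \<noteq> [] \<and> hd xs = a \<and> last xs = b \<and> distinct xs \<and> successively R xs"
    using assms
  proof (induction rule: converse_rtranclp_induct)
    case base
    show ?case by (intro exI[of _ "[b]"]) simp
  next
    case (step a c)
    then obtain xs where xs: "xs \<noteq> []" "hd xs = c" "last xs = b" "distinct xs" "successively R xs" by blast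
    show ?case
    proof (cases "a \<in> set xs")
      case False
      then show ?thesis using xs step.hyps(1)
        by (intro exI[of _ "a # xs"]) (cases xs, auto simp: successively_Cons)
    next
      case True
      then obtain ys zs where "xs = ys @ a # zs" by (meson split_list)
      then show ?thesis using xs
        by (intro exI[of _ "a # zs"]) (auto simp: successively_append_iff)
    qed
  qed
  then show ?thesis using that by blast
qed

text \<open>
  A tree has no proper connected spanning subgraph: an edge outside of it would close a cycle with
  a path inside of it.
\<close>

lemma connected_acyclic_le:
  assumes "F \<subseteq> E" "graph_connected V F" "simple_graph V E" "\<nexists>xs. graph_cycle E xs"
  shows "F = E"
proof (rule ccontr)
  assume "F \<noteq> E"
  then obtain e where e: "e \<in> E" "e \<notin> F" using assms(1) by blast
  then obtain a b where ab: "e = {a, b}" "a \<in> V" "b \<in> V" "a \<noteq> b"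
    using assms(3) unfolding simple_graph_def by blast
  have "(\<lambda>x y. {x, y} \<in> F)\<^sup>*\<^sup>* a b" using assms(2) ab by (simp add: graph_connected_def)
  then obtain xs where xs: "xs \<noteq> []" "hd xs = a" "last xs = b" "distinct xs" "successively (\<lambda>x y. {x, y} \<in> F) xs"
    by (rule rtranclp_shortest_path)
  have "successively (\<lambda>x y. {x, y} \<in> E) xs"
    using xs(5) by (rule successively_mono) (use assms(1) in auto)
  moreover have "length xs \<ge> 3"
  proof (rule ccontr)
    assume "\<not> length xs \<ge> 3"
    then have "length xs = 1 \<or> length xs = 2" using length_greater_0_conv[of xs] xs(1) by linarith
    then show False
    proof
      assume "length xs = 1"
      then show False using xs ab by (cases xs) auto
    next
      assume "length xs = 2"
      then obtain x y where "xs = [x, y]" by (auto simp: numeral_2_eq_2 length_Suc_conv)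
      then show False using xs ab e by auto
    qed
  qed
  ultimately have "graph_cycle E xs"
    using xs e ab by (auto simp: graph_cycle_def insert_commute)
  then show False using assms(4) by blast
qed

text \<open>
  For acyclicity, look at a vertex of maximal height on a cycle: both of its neighbours on the
  cycle would have to be its parent.
\<close>

lemma rooted_parent_edges_is_tree:
  assumes fin: "finite V" and v: "v \<in> V" and f: "f \<in> parent_maps {v} (V - {v})"
  shows "is_tree V (parent_edges (V - {v}) f)"
proof -
  let ?U = "V - {v}" and ?E = "parent_edges (V - {v}) f"
  obtain r :: "'a \<Rightarrow> nat" where r: "\<And>u. u \<in> ?U \<Longrightarrow> r (f u) < r u"
    by (rule parent_maps_height[OF f]) auto
  have range: "f u \<in> V" if "u \<in> ?U" for u
    using f that v by (auto simp: parent_maps_def PiE_iff)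
  have simple: "simple_graph V ?E"
    unfolding simple_graph_def
  proof (intro conjI fin subsetI)
    fix e assume "e \<in> ?E"
    then obtain u where u: "u \<in> ?U" "e = {u, f u}" by (auto simp: parent_edges_def)
    moreover have "u \<noteq> f u" using r[OF u(1)] by auto
    ultimately show "e \<in> {{u, v} |u v. u \<in> V \<and> v \<in> V \<and> u \<noteq> v}" using range by blast
  qed
  let ?R = "\<lambda>x y. {x, y} \<in> ?E"
  have to_root: "?R\<^sup>*\<^sup>* u v \<and> ?R\<^sup>*\<^sup>* v u" if "reaches ?U f {v} u" for u
    using that
  proof induction
    case (step u)
    then have "?R u (f u)" "?R (f u) u" by (auto simp: mem_parent_edges)
    then show ?case using step.IH by (auto intro: converse_rtranclp_into_rtranclp rtranclp.rtrancl_into_rtrancl)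
  qed auto
  have conn: "graph_connected V ?E"
    unfolding graph_connected_def
  proof (intro conjI ballI)
    fix a b assume "a \<in> V" "b \<in> V"
    then have "reaches ?U f {v} a" "reaches ?U f {v} b"
      using f by (auto simp: parent_maps_def intro: reaches.base)
    then show "?R\<^sup>*\<^sup>* a b" using to_root by (meson rtranclp_trans)
  qed (use v in auto)
  have "\<not> graph_cycle ?E xs" for xs
  proof
    assume "graph_cycle ?E xs"
    then have len: "length xs \<ge> 3" and dist: "distinct xs"
      and succ: "successively ?R xs" and close: "?R (last xs) (hd xs)"
      by (auto simp: graph_cycle_def)
    define n where "n = length xs"
    have edge: "?R (xs ! i) (xs ! (Suc i mod n))" if "i < n" for i
    proof (cases "Suc i < n")
      case True
      then show ?thesis using succ by (simp add: n_def successively_conv_nth)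
    next
      case False
      then have "Suc i = n" using that by simp
      then show ?thesis using close len
        by (metis diff_Suc_1 hd_conv_nth last_conv_nth length_0_conv mod_self n_def not_numeral_le_zero)
    qed
    obtain i where i: "i < n" "\<And>j. j < n \<Longrightarrow> r (xs ! j) \<le> r (xs ! i)"
    proof -
      have "finite ((\<lambda>j. r (xs ! j)) ` {..<n})" "(\<lambda>j. r (xs ! j)) ` {..<n} \<noteq> {}"
        using len by (auto simp: n_def lessThan_empty_iff)
      \<comment> \<open>A vertex of maximal height on the cycle; its two neighbours there are at the positions
        \<open>i + 1\<close> and \<open>p\<close> modulo \<open>n\<close>.\<close>
      then obtain i where "i < n" "r (xs ! i) = Max ((\<lambda>j. r (xs ! j)) ` {..<n})"
        using Max_in by (metis (no_types, lifting) image_iff lessThan_iff)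
      then show ?thesis by (intro that) (auto intro!: Max_ge)
    qed
    define p where "p = (if i = 0 then n - 1 else i - 1)"
    have p: "p < n" "Suc p mod n = i" using i len by (auto simp: p_def n_def)
    have down: "f (xs ! i) = xs ! j" if "j < n" "?R (xs ! i) (xs ! j)" for j
    proof -
      have "\<not> (xs ! j \<in> ?U \<and> f (xs ! j) = xs ! i)"
        using r[of "xs ! j"] i(2)[OF that(1)] by auto
      then show ?thesis using that by (auto simp: mem_parent_edges)
    qed
    have "f (xs ! i) = xs ! (Suc i mod n)" 
      using len by (intro down edge[OF i(1)] mod_less_divisor) (auto simp: n_def)
    moreover have "f (xs ! i) = xs ! p" using edge[OF p(1)] p by (intro down) (auto simp: insert_commute)
    moreover have "Suc i mod n < n" using i by (intro mod_less_divisor) auto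
    ultimately have "Suc i mod n = p" using nth_eq_iff_index_eq[OF dist] p by (simp add: n_def)
    then show False using len i p by (auto simp: p_def n_def mod_Suc split: if_splits)
  qed
  then show ?thesis using simple conn by (simp add: is_tree_def)
qed

text \<open>
  A vertex is sent to a neighbour that is closer to \<open>v\<close>. The resulting edges form a connected
  spanning subgraph, hence all of the tree.
\<close>

lemma tree_has_parent_map:
  assumes v: "v \<in> V" and T: "is_tree V E"
  shows "\<exists>f\<in>parent_maps {v} (V - {v}). parent_edges (V - {v}) f = E"
proof -
  let ?R = "\<lambda>x y. {x, y} \<in> E"
  define dist where "dist u = (LEAST n. (?R ^^ n) u v)" for u
  have fin: "finite V" using T by (simp add: is_tree_def simple_graph_def)
  have edge: "x \<in> V \<and> y \<in> V" if "?R x y" for x y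
  proof -
    from that T obtain a b where "{x, y} = {a, b}" "a \<in> V" "b \<in> V"
      unfolding is_tree_def simple_graph_def by blast
    then show ?thesis by (auto simp: doubleton_eq_iff)
  qed
  have ex: "\<exists>w. ?R u w \<and> dist w < dist u" if u: "u \<in> V - {v}" for u
  proof -
    have "?R\<^sup>*\<^sup>* u v" using T u v by (auto simp: is_tree_def graph_connected_def)
    then obtain n where "(?R ^^ n) u v" by (auto simp: rtranclp_power)
    then have least: "(?R ^^ dist u) u v" unfolding dist_def by (rule LeastI)
    obtain m where m: "dist u = Suc m"
      using least u by (cases "dist u") auto
    obtain w where w: "?R u w" "(?R ^^ m) w v"
      using relpowp_Suc_D2[OF least[unfolded m]] by blast
    then have "dist w \<le> m" unfolding dist_def by (intro Least_le)
    then show ?thesis using w m by auto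
  qed
  define f where "f = restrict (\<lambda>u. SOME w. ?R u w \<and> dist w < dist u) (V - {v})"
  have f: "?R u (f u) \<and> dist (f u) < dist u" if "u \<in> V - {v}" for u
    using someI_ex[OF ex[OF that]] that by (simp add: f_def)
  have "reaches (V - {v}) f {v} u" if "u \<in> V" for u
    using that
  proof (induction "dist u" arbitrary: u rule: less_induct)
    case less
    show ?case
    proof (cases "u = v")
      case True
      then show ?thesis by (simp add: reaches.base)
    next
      case False
      then have u: "u \<in> V - {v}" using less.prems by simp
      then have "reaches (V - {v}) f {v} (f u)" using f[OF u] edge by (intro less.hyps) auto
      with u show ?thesis by (rule reaches.step)
    qed
  qed
  moreover have "f \<in> V - {v} \<rightarrow>\<^sub>E (V - {v}) \<union> {v}"
    using f edge by (auto simp: PiE_iff f_def)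
  ultimately have mem: "f \<in> parent_maps {v} (V - {v})" by (auto simp: parent_maps_def)
  have "parent_edges (V - {v}) f \<subseteq> E" using f by (auto simp: parent_edges_def)
  moreover have "graph_connected V (parent_edges (V - {v}) f)"
    using rooted_parent_edges_is_tree[OF fin v mem] by (simp add: is_tree_def)
  ultimately have "parent_edges (V - {v}) f = E"
    using T by (intro connected_acyclic_le) (auto simp: is_tree_def)
  then show ?thesis using mem by blast
qed

text \<open>
  By induction on the height in \<open>g\<close>: if \<open>f\<close> did not map \<open>u\<close> to \<open>g u\<close>, the edge between the two would
  come from \<open>f (g u) = u\<close>, and the induction hypothesis at \<open>g u\<close> would produce a 2-cycle of \<open>g\<close>.
\<close>

lemma parent_edges_inj:
  assumes f: "f \<in> parent_maps X U" and g: "g \<in> parent_maps X U" and disj: "X \<inter> U = {}"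
    and eq: "parent_edges U f = parent_edges U g"
  shows "f = g"
proof -
  obtain r :: "'a \<Rightarrow> nat" where r: "\<And>u. u \<in> U \<Longrightarrow> r (g u) < r u"
    by (rule parent_maps_height[OF g disj]) blast
  have "f u = g u" if "u \<in> U" for u
    using that
  proof (induction "r u" arbitrary: u rule: less_induct)
    case less
    show ?case
    proof (rule ccontr)
      assume ne: "f u \<noteq> g u"
      have "{u, g u} \<in> parent_edges U f" using less.prems by (simp add: eq mem_parent_edges)
      then have w: "g u \<in> U" "f (g u) = u" using ne by (auto simp: mem_parent_edges)
      then have "g (g u) = u" using less.hyps[of "g u"] r[OF less.prems] by simp
      then show False using r[OF less.prems] r[OF w(1)] by simp
    qed
  qed
  moreover have "f u = g u" if "u \<notin> U" for u
    using f g that by (auto simp: parent_maps_def PiE_iff extensional_def)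
  ultimately show ?thesis by blast
qed

lemma bij_betw_parent_maps_trees:
  assumes "finite V" "v \<in> V"
  shows "bij_betw (parent_edges (V - {v})) (parent_maps {v} (V - {v})) {E. is_tree V E}"
  unfolding bij_betw_def
proof
  show "inj_on (parent_edges (V - {v})) (parent_maps {v} (V - {v}))"
    using parent_edges_inj by (auto intro!: inj_onI)
  show "parent_edges (V - {v}) ` parent_maps {v} (V - {v}) = {E. is_tree V E}"
    using rooted_parent_edges_is_tree[OF assms] tree_has_parent_map[OF assms(2)] by blast
qed

section \<open>Crossed Abel sums\<close>

text \<open>
  The \<open>m\<close>-th finite difference of a power of degree at most \<open>m\<close>. In the induction, one factor
  \<open>z + i\<close> is split off and \<open>i (m choose i) = m (m-1 choose i-1)\<close> is used.
\<close>

lemma alternating_binomial_power_sum: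
  fixes z :: real
  assumes "j \<le> m"
  shows "(\<Sum>i\<le>m. (-1) ^ i * real (m choose i) * (z + i) ^ j) = (if j = m then (-1) ^ m * fact m else 0)"
  using assms
proof (induction j arbitrary: m z)
  case 0
  then show ?case
    using choose_alternating_sum[of m, where 'a = real] by (cases "m = 0") auto
next
  case (Suc j)
  then obtain m' where m: "m = Suc m'" by (cases m) auto
  have "(\<Sum>i\<le>m. (-1) ^ i * real (m choose i) * (z + i) ^ Suc j)
      = z * (\<Sum>i\<le>m. (-1) ^ i * real (m choose i) * (z + i) ^ j)
        + (\<Sum>i\<le>m. (-1) ^ i * real (m choose i) * i * (z + i) ^ j)"
    by (simp add: sum_distrib_left sum.distrib[symmetric] algebra_simps)
  also have "(\<Sum>i\<le>m. (-1) ^ i * real (m choose i) * i * (z + i) ^ j)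
      = (\<Sum>i\<le>m'. (-1) ^ Suc i * real (m choose Suc i) * Suc i * (z + Suc i) ^ j)"
    unfolding m by (subst sum.atMost_Suc_shift) simp
  also have "\<dots> = - real m * (\<Sum>i\<le>m'. (-1) ^ i * real (m' choose i) * ((z + 1) + i) ^ j)"
  proof -
    have *: "real (m choose Suc i) * Suc i = real m * real (m' choose i)" for i
      unfolding m by (metis Suc_times_binomial mult.commute of_nat_mult)
    show ?thesis
      unfolding sum_distrib_left
    proof (rule sum.cong[OF refl])
      fix i
      have "(-1) ^ Suc i * real (m choose Suc i) * Suc i * (z + Suc i) ^ j
          = (-1) ^ Suc i * (real (m choose Suc i) * Suc i) * (z + Suc i) ^ j" by simp
      also have "\<dots> = - real m * ((-1) ^ i * real (m' choose i) * ((z + 1) + i) ^ j)"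
        unfolding * by (simp add: add_ac)
      finally show "(-1) ^ Suc i * real (m choose Suc i) * Suc i * (z + Suc i) ^ j
          = - real m * ((-1) ^ i * real (m' choose i) * ((z + 1) + i) ^ j)" .
    qed
  qed
  also have "(\<Sum>i\<le>m. (-1) ^ i * real (m choose i) * (z + i) ^ j) = 0"
    using Suc.prems by (subst Suc.IH) auto
  also have "(\<Sum>i\<le>m'. (-1) ^ i * real (m' choose i) * ((z + 1) + i) ^ j)
      = (if j = m' then (-1) ^ m' * fact m' else 0)"
    using Suc.prems by (intro Suc.IH) (simp add: m)
  finally have eq: "(\<Sum>i\<le>m. (-1) ^ i * real (m choose i) * (z + i) ^ Suc j)
      = z * 0 + - real m * (if j = m' then (-1) ^ m' * fact m' else 0)" .
  show ?case unfolding eq by (simp add: m algebra_simps)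
qed

text \<open>
  A relative of Abel's binomial identity in which the two exponents are interchanged. With
  \<open>N = x + y + n\<close>, the base \<open>y + (n - k)\<close> equals \<open>N - (x + k)\<close>; expanding its power turns the
  coefficient of each power \<open>N\<^bsup>j\<^esup>\<close> into an \<open>(n - j)\<close>-th difference of a polynomial of the same degree,
  which is a constant.
\<close>

lemma crossed_abel_sum:
  fixes x y :: real
  shows "(\<Sum>k\<le>n. real (n choose k) * (x + k) ^ (n - k) * (y + real (n - k)) ^ k)
       = (\<Sum>h\<le>n. (-1) ^ h * (fact n / fact (n - h)) * (x + y + n) ^ (n - h))"
proof -
  define N where "N = x + y + n"
  have "(\<Sum>k\<le>n. real (n choose k) * (x + k) ^ (n - k) * (y + real (n - k)) ^ k)
      = (\<Sum>k\<le>n. \<Sum>j\<le>k. real (n choose k) * real (k choose j) * (-1) ^ (k - j) * N ^ j * (x + k) ^ (n - j))"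
  proof (rule sum.cong[OF refl])
    fix k assume "k \<in> {..n}"
    then have k: "k \<le> n" by simp
    then have "y + real (n - k) = N + - (x + k)" by (simp add: N_def of_nat_diff)
    then have "real (n choose k) * (x + k) ^ (n - k) * (y + real (n - k)) ^ k
      = real (n choose k) * (x + k) ^ (n - k) * (\<Sum>j\<le>k. real (k choose j) * N ^ j * (- (x + k)) ^ (k - j))"
      by (simp only: binomial_ring)
    also have "\<dots> = (\<Sum>j\<le>k. real (n choose k) * real (k choose j) * (-1) ^ (k - j) * N ^ j * (x + k) ^ (n - j))"
      unfolding sum_distrib_left
    proof (rule sum.cong[OF refl])
      fix j assume "j \<in> {..k}"
      then have "n - j = (n - k) + (k - j)" using k by auto
      then show "real (n choose k) * (x + k) ^ (n - k) * (real (k choose j) * N ^ j * (- (x + k)) ^ (k - j))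
        = real (n choose k) * real (k choose j) * (-1) ^ (k - j) * N ^ j * (x + k) ^ (n - j)"
        by (subst power_minus) (simp add: power_add)
    qed
    finally show "real (n choose k) * (x + k) ^ (n - k) * (y + real (n - k)) ^ k
      = (\<Sum>j\<le>k. real (n choose k) * real (k choose j) * (-1) ^ (k - j) * N ^ j * (x + k) ^ (n - j))" .
  qed
  also have "\<dots> = (\<Sum>j\<le>n. \<Sum>k\<in>{j..n}. real (n choose k) * real (k choose j) * (-1) ^ (k - j) * N ^ j * (x + k) ^ (n - j))"
    by (subst sum.Sigma, simp, simp, subst sum.Sigma, simp, simp)
      (rule sum.reindex_bij_witness[of _ "\<lambda>(a, b). (b, a)" "\<lambda>(a, b). (b, a)"]; auto)
  also have "\<dots> = (\<Sum>j\<le>n. (-1) ^ (n - j) * (fact n / fact j) * N ^ j)"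
  proof (rule sum.cong[OF refl])
    fix j assume "j \<in> {..n}"
    then have j: "j \<le> n" by simp
    have "(\<Sum>k\<in>{j..n}. real (n choose k) * real (k choose j) * (-1) ^ (k - j) * N ^ j * (x + k) ^ (n - j))
      = (\<Sum>i\<le>n - j. real (n choose (i + j)) * real ((i + j) choose j) * (-1) ^ i * N ^ j * (x + (i + j)) ^ (n - j))"
      by (rule sum.reindex_bij_witness[of _ "\<lambda>i. i + j" "\<lambda>k. k - j"]) (use j in auto)
    also have "\<dots> = (\<Sum>i\<le>n - j. N ^ j * real (n choose j) * ((-1) ^ i * real ((n - j) choose i) * ((x + j) + i) ^ (n - j)))"
    proof (rule sum.cong[OF refl])
      fix i assume "i \<in> {..n - j}"
      then have "(n choose (i + j)) * ((i + j) choose j) = (n choose j) * ((n - j) choose i)"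
        using j choose_mult[of j "i + j" n] by auto
      then have "real (n choose (i + j)) * real ((i + j) choose j) = real (n choose j) * real ((n - j) choose i)"
        by (metis of_nat_mult)
      then show "real (n choose (i + j)) * real ((i + j) choose j) * (-1) ^ i * N ^ j * (x + (i + j)) ^ (n - j)
        = N ^ j * real (n choose j) * ((-1) ^ i * real ((n - j) choose i) * ((x + j) + i) ^ (n - j))"
        by (simp add: algebra_simps)
    qed
    also have "\<dots> = N ^ j * real (n choose j) * ((-1) ^ (n - j) * fact (n - j))"
      unfolding sum_distrib_left[symmetric]
      by (subst alternating_binomial_power_sum) auto
    also have "\<dots> = (-1) ^ (n - j) * (fact n / fact j) * N ^ j"
      using j by (simp add: binomial_fact)
    finally show "(\<Sum>k\<in>{j..n}. real (n choose k) * real (k choose j) * (-1) ^ (k - j) * N ^ j * (x + k) ^ (n - j))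
      = (-1) ^ (n - j) * (fact n / fact j) * N ^ j" .
  qed
  also have "\<dots> = (\<Sum>h\<le>n. (-1) ^ h * (fact n / fact (n - h)) * N ^ (n - h))"
    by (rule sum.reindex_bij_witness[of _ "\<lambda>j. n - j" "\<lambda>j. n - j"]) auto
  finally show ?thesis unfolding N_def .
qed

text \<open>
  The sum \<open>A\<^sub>n\<close> of the introduction.
\<close>

definition alternating_falling_sum :: "nat \<Rightarrow> real" where
  "alternating_falling_sum n = (\<Sum>h\<le>n. (-1) ^ h * (fact n / fact (n - h)) / real n ^ h)"

lemma sum_odd_weight:
  assumes "n \<ge> 1"
  shows "(\<Sum>k\<le>n. real (n - k) * even_height_weight n k) = real n ^ n * alternating_falling_sum n"
proof -
  have "(\<Sum>k\<le>n. real (n - k) * even_height_weight n k)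
      = (\<Sum>k\<le>n. real (n choose k) * (0 + real k) ^ (n - k) * (0 + real (n - k)) ^ k)"
  proof (rule sum.cong[OF refl])
    fix k
    show "real (n - k) * even_height_weight n k = real (n choose k) * (0 + real k) ^ (n - k) * (0 + real (n - k)) ^ k"
      using assms by (cases k) (auto simp: even_height_weight_def)
  qed
  also have "\<dots> = (\<Sum>h\<le>n. (-1) ^ h * (fact n / fact (n - h)) * real n ^ (n - h))"
    by (subst crossed_abel_sum) simp
  also have "\<dots> = real n ^ n * alternating_falling_sum n"
    unfolding alternating_falling_sum_def sum_distrib_left
    using assms by (intro sum.cong) (auto simp: power_diff field_simps)
  finally show ?thesis .
qed

text \<open>
  Both \<open>\<Sum>k. k w k\<close> and \<open>\<Sum>k. (n - k) w k\<close> are crossed Abel sums, for \<open>n - 1\<close> (up to a factor \<open>n\<close>) and for \<open>n\<close>. Their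
  alternating expansions cancel except for the leading term \<open>n\<^bsup>n\<^esup>\<close>.
\<close>

lemma sum_weight:
  assumes "n \<ge> 1"
  shows "(\<Sum>k\<le>n. even_height_weight n k) = real n ^ (n - 1)"
proof -
  obtain m where n: "n = Suc m" using assms by (cases n) auto
  have "(\<Sum>k\<le>n. real k * even_height_weight n k)
      = (\<Sum>k\<le>m. real (Suc k) * even_height_weight n (Suc k))"
    unfolding n by (subst sum.atMost_Suc_shift) simp
  also have "\<dots> = real n * (\<Sum>k\<le>m. real (m choose k) * (1 + real k) ^ (m - k) * (0 + real (m - k)) ^ k)"
    unfolding sum_distrib_left
  proof (rule sum.cong[OF refl])
    fix k
    have "real (Suc k) * real (n choose Suc k) = real n * real (m choose k)"
      unfolding n by (metis Suc_times_binomial of_nat_mult)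
    then show "real (Suc k) * even_height_weight n (Suc k)
      = real n * (real (m choose k) * (1 + real k) ^ (m - k) * (0 + real (m - k)) ^ k)"
      by (simp add: even_height_weight_def n)
  qed
  also have "\<dots> = (\<Sum>h\<le>m. (-1) ^ h * (fact n / fact (m - h)) * real n ^ (m - h))"
    by (subst crossed_abel_sum)
      (auto simp: sum_distrib_left n add_ac field_simps intro!: sum.cong)
  finally have even: "(\<Sum>k\<le>n. real k * even_height_weight n k)
      = (\<Sum>h\<le>m. (-1) ^ h * (fact n / fact (m - h)) * real n ^ (m - h))" .
  have "real n ^ n * alternating_falling_sum n = (\<Sum>h\<le>n. (-1) ^ h * (fact n / fact (n - h)) * real n ^ (n - h))"
    unfolding alternating_falling_sum_def sum_distrib_left
    using assms by (intro sum.cong) (auto simp: power_diff field_simps)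
  also have "\<dots> = real n ^ n - (\<Sum>h\<le>m. (-1) ^ h * (fact n / fact (m - h)) * real n ^ (m - h))"
    unfolding n by (subst sum.atMost_Suc_shift) (simp add: sum_negf)
  finally have "(\<Sum>k\<le>n. real k * even_height_weight n k) + (\<Sum>k\<le>n. real (n - k) * even_height_weight n k) = real n ^ n"
    using even sum_odd_weight[OF assms] by simp
  also have "(\<Sum>k\<le>n. real k * even_height_weight n k) + (\<Sum>k\<le>n. real (n - k) * even_height_weight n k)
      = real n * (\<Sum>k\<le>n. even_height_weight n k)"
    unfolding sum_distrib_left sum.distrib[symmetric]
    by (intro sum.cong) (auto simp: algebra_simps of_nat_diff)
  finally show ?thesis unfolding n by simp
qed

lemma mean_imbalance:
  assumes "n \<ge> 1"
  shows "(\<Sum>k\<le>n. (2 * real k - n) * (even_height_weight n k / real n ^ (n - 1)))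
     = n * (1 - 2 * alternating_falling_sum n)"
proof -
  obtain m where n: "n = Suc m" using assms by (cases n) auto
  have "(\<Sum>k\<le>n. (2 * real k - n) * even_height_weight n k)
    = real n * (\<Sum>k\<le>n. even_height_weight n k) - 2 * (\<Sum>k\<le>n. real (n - k) * even_height_weight n k)"
    unfolding sum_distrib_left sum_subtractf[symmetric]
    by (intro sum.cong) (auto simp: algebra_simps of_nat_diff)
  also have "\<dots> = real n * real n ^ (n - 1) * (1 - 2 * alternating_falling_sum n)"
    unfolding sum_weight[OF assms] sum_odd_weight[OF assms] by (simp add: n algebra_simps)
  finally have "(\<Sum>k\<le>n. (2 * real k - n) * even_height_weight n k) / real n ^ (n - 1)
     = n * (1 - 2 * alternating_falling_sum n)" by (simp add: n)
  then show ?thesis by (simp add: sum_divide_distrib)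
qed

section \<open>The law of the size of the greedy independent set\<close>

text \<open>
  Forgetting the root \<open>v\<close> and its set \<open>D\<close> of children is a bijection onto the parent maps with
  target \<open>D\<close>.
\<close>

lemma sum_root_children:
  fixes h :: "('a \<Rightarrow> 'a) \<Rightarrow> real"
  assumes v: "v \<notin> U" and D: "D \<subseteq> U"
  shows "(\<Sum>f\<in>{f \<in> parent_maps {v} U. {u \<in> U. f u = v} = D}. h (restrict f (U - D))) = (\<Sum>g\<in>parent_maps D (U - D). h g)"
proof -
  define ext where "ext g = (\<lambda>u. if u \<in> D then v else g u)" for g :: "'a \<Rightarrow> 'a"
  show ?thesis
  proof (rule sum.reindex_bij_witness[of _ ext "\<lambda>f. restrict f (U - D)"])
    fix f assume "f \<in> {f \<in> parent_maps {v} U. {u \<in> U. f u = v} = D}"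
    then have f: "f \<in> parent_maps {v} U" and fD: "{u \<in> U. f u = v} = D" by auto
    show "ext (restrict f (U - D)) = f"
    proof
      fix u
      show "ext (restrict f (U - D)) u = f u"
        using f fD by (cases "u \<in> U") (auto simp: ext_def parent_maps_def PiE_iff extensional_def)
    qed
    have "reaches (U - D) (restrict f (U - D)) D u" if "reaches U f {v} u" "u \<noteq> v" for u
      using that
    proof induction
      case (step u)
      show ?case
      proof (cases "u \<in> D")
        case True
        then show ?thesis by (rule reaches.base)
      next
        case False
        then have u: "u \<in> U - D" "f u \<noteq> v" using step.hyps fD by auto
        then show ?thesis using step.IH by (rule_tac reaches.step) auto
      qed
    qed simp
    then have "\<forall>u\<in>U - D. reaches (U - D) (restrict f (U - D)) D u"
      using f v unfolding parent_maps_def by blast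
    moreover have "restrict f (U - D) \<in> U - D \<rightarrow>\<^sub>E (U - D) \<union> D"
      using f fD by (auto simp: parent_maps_def PiE_iff)
    ultimately show "restrict f (U - D) \<in> parent_maps D (U - D)" by (simp add: parent_maps_def)
  next
    fix g assume g: "g \<in> parent_maps D (U - D)"
    have undef: "g u = undefined" if "u \<notin> U - D" for u
      using g that by (auto simp: parent_maps_def PiE_iff extensional_def)
    have range: "g u \<in> U" if "u \<in> U - D" for u
      using g that D by (auto simp: parent_maps_def PiE_iff)
    show "restrict (ext g) (U - D) = g"
      using undef by (auto simp: fun_eq_iff ext_def)
    have "reaches U (ext g) {v} u" if "reaches (U - D) g D u" for u
      using that
    proof induction
      case (base u)
      then show ?case using D by (rule_tac reaches.step) (auto simp: ext_def intro: reaches.base)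
    next
      case (step u)
      then show ?case by (rule_tac reaches.step) (auto simp: ext_def)
    qed
    then have "\<forall>u\<in>U. reaches U (ext g) {v} u"
      using g unfolding parent_maps_def by (blast intro: reaches.base)
    moreover have "ext g \<in> U \<rightarrow>\<^sub>E U \<union> {v}"
      using range undef D by (auto simp: PiE_iff ext_def extensional_def)
    moreover have "{u \<in> U. ext g u = v} = D"
      using range v D by (auto simp: ext_def)
    ultimately show "ext g \<in> {f \<in> parent_maps {v} U. {u \<in> U. f u = v} = D}" by (simp add: parent_maps_def)
  qed simp
qed

text \<open>
  The trees are rooted at the first active vertex \<open>v\<close>, whatever \<open>v\<close> is.
\<close>

lemma sum_trees_first_vertex:
  assumes fin: "finite V" and v: "v \<in> V"
  shows "(\<Sum>E\<in>{E. is_tree V E}. size_prob E (V - insert v {w. {v, w} \<in> E}) k)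
    = even_height_weight (card V) (Suc k) / card V"
proof -
  let ?U = "V - {v}"
  have finU: "finite ?U" using fin by simp
  have V: "card V = Suc (card ?U)" using fin v by (metis card.remove)
  have "(\<Sum>E\<in>{E. is_tree V E}. size_prob E (V - insert v {w. {v, w} \<in> E}) k)
    = (\<Sum>f\<in>parent_maps {v} ?U. size_prob (parent_edges ?U f) (V - insert v {w. {v, w} \<in> parent_edges ?U f}) k)"
    by (rule sum.reindex_bij_betw[OF bij_betw_parent_maps_trees[OF fin v], symmetric])
  also have "\<dots> = (\<Sum>f\<in>parent_maps {v} ?U. size_prob (parent_edges ?U f) (?U - {u \<in> ?U. f u = v}) k)"
  proof (rule sum.cong[OF refl])
    fix f
    have "V - insert v {w. {v, w} \<in> parent_edges ?U f} = ?U - {u \<in> ?U. f u = v}"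
      by (auto simp: mem_parent_edges)
    then show "size_prob (parent_edges ?U f) (V - insert v {w. {v, w} \<in> parent_edges ?U f}) k
      = size_prob (parent_edges ?U f) (?U - {u \<in> ?U. f u = v}) k" by simp
  qed
  also have "\<dots> = (\<Sum>D\<in>Pow ?U. \<Sum>f\<in>{f \<in> parent_maps {v} ?U. {u \<in> ?U. f u = v} = D}.
      size_prob (parent_edges ?U f) (?U - {u \<in> ?U. f u = v}) k)"
    using finU by (intro sum.group[symmetric]) (auto simp: finite_parent_maps)
  also have "\<dots> = (\<Sum>D\<in>Pow ?U. forest_weight (card D) (card ?U - card D) k)"
  proof (rule sum.cong[OF refl])
    fix D assume "D \<in> Pow ?U"
    then have D: "D \<subseteq> ?U" "finite D" using finU finite_subset by auto
    have "(\<Sum>f\<in>{f \<in> parent_maps {v} ?U. {u \<in> ?U. f u = v} = D}. size_prob (parent_edges ?U f) (?U - {u \<in> ?U. f u = v}) k)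
      = (\<Sum>f\<in>{f \<in> parent_maps {v} ?U. {u \<in> ?U. f u = v} = D}. size_prob (parent_edges (?U - D) (restrict f (?U - D))) (?U - D) k)"
    proof (rule sum.cong[OF refl])
      fix f assume "f \<in> {f \<in> parent_maps {v} ?U. {u \<in> ?U. f u = v} = D}"
      then have "{u \<in> ?U. f u = v} = D" by simp
      then show "size_prob (parent_edges ?U f) (?U - {u \<in> ?U. f u = v}) k
        = size_prob (parent_edges (?U - D) (restrict f (?U - D))) (?U - D) k"
        using finU by (simp only:) (intro size_prob_cong, auto simp: mem_parent_edges)
    qed
    also have "\<dots> = forest_sum D (?U - D) k"
      unfolding forest_sum_def by (rule sum_root_children[OF _ D(1)]) simp
    also have "\<dots> = forest_weight (card D) (card ?U - card D) k"
      using finU D by (subst forest_sum_eq_weight) (auto simp: card_Diff_subset)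
    finally show "(\<Sum>f\<in>{f \<in> parent_maps {v} ?U. {u \<in> ?U. f u = v} = D}. size_prob (parent_edges ?U f) (?U - {u \<in> ?U. f u = v}) k)
      = forest_weight (card D) (card ?U - card D) k" .
  qed
  also have "\<dots> = (\<Sum>d\<le>card ?U. real (card ?U choose d) * forest_weight d (card ?U - d) k)"
    by (rule sum_Pow_card[OF finU, of "\<lambda>d. forest_weight d (card ?U - d) k"])
  also have "\<dots> = even_height_weight (card V) (Suc k) / card V"
    unfolding forest_weight_first_step V ..
  finally show ?thesis .
qed

lemma sum_trees_size_prob:
  assumes fin: "finite V" and V: "V \<noteq> {}"
  shows "(\<Sum>E\<in>{E. is_tree V E}. size_prob E V k) = even_height_weight (card V) k / card V"
proof (cases k)
  case 0
  then show ?thesis using size_prob_0[OF fin V] V fin by (simp add: even_height_weight_def card_gt_0_iff)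
next
  case (Suc j)
  have "(\<Sum>E\<in>{E. is_tree V E}. size_prob E V k)
     = (\<Sum>v\<in>V. \<Sum>E\<in>{E. is_tree V E}. size_prob E (V - insert v {w. {v, w} \<in> E}) j) / card V"
    unfolding Suc size_prob_Suc[OF fin V] sum_divide_distrib[symmetric]
    by (subst sum.swap) (rule refl)
  also have "\<dots> = even_height_weight (card V) k / card V"
    using fin V by (simp add: sum_trees_first_vertex Suc)
  finally show ?thesis .
qed

text \<open>
  The forest recursion gives the probabilities up to a common factor. Comparing total masses, \<open>1\<close> and
  \<open>n\<^bsup>n-1\<^esup>\<close>, determines this factor.
\<close>

theorem pmf_greedy_size_law:
  assumes n: "n \<ge> 1"
  shows "pmf (greedy_size_law n) k = even_height_weight n k / real n ^ (n - 1)"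
proof -
  define c where "c = n * card (cayley_trees n)"
  have trees: "cayley_trees n = {E. is_tree {1..n} E}" by (simp add: cayley_trees_def)
  have pmf: "pmf (greedy_size_law n) k = even_height_weight n k / c" for k
  proof -
    have "pmf (greedy_size_law n) k = (\<Sum>E\<in>cayley_trees n. size_prob E {1..n} k) / card (cayley_trees n)"
      unfolding greedy_size_law_def greedy_independent_set_def size_prob_def
      by (rule pmf_bind_pmf_of_set[OF cayley_trees_nonempty[OF n] finite_cayley_trees])
    also have "(\<Sum>E\<in>cayley_trees n. size_prob E {1..n} k) = even_height_weight n k / n"
      unfolding trees using n by (subst sum_trees_size_prob) auto
    finally show ?thesis by (simp add: c_def)
  qed
  have "set_pmf (greedy_size_law n) \<subseteq> {..n}"
  proof
    fix k assume "k \<in> set_pmf (greedy_size_law n)"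
    then have "even_height_weight n k \<noteq> 0" using pmf[of k] by (auto simp: set_pmf_iff)
    then show "k \<in> {..n}" by (auto simp: even_height_weight_def)
  qed
  then have "1 = (\<Sum>k\<le>n. pmf (greedy_size_law n) k)" by (subst sum_pmf_eq_1) auto
  also have "\<dots> = real n ^ (n - 1) / c"
    unfolding pmf sum_divide_distrib[symmetric] sum_weight[OF n] ..
  finally have "real c = real n ^ (n - 1)" by (auto simp: field_simps split: if_splits)
  then show ?thesis by (simp add: pmf)
qed

section \<open>Reflection of the law and the coupling\<close>

lemma partial_sums_nonneg_if_sign_change:
  fixes d :: "nat \<Rightarrow> real"
  assumes "\<And>i. i < m \<Longrightarrow> i < c \<Longrightarrow> d i \<ge> 0" "\<And>i. i < m \<Longrightarrow> c \<le> i \<Longrightarrow> d i \<le> 0"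
    and "(\<Sum>i<m. d i) = 0" and "j \<le> m"
  shows "(\<Sum>i<j. d i) \<ge> 0"
proof (cases "j \<le> c")
  case True
  then show ?thesis using assms by (intro sum_nonneg) auto
next
  case False
  have "(\<Sum>i<m. d i) = (\<Sum>i<j. d i) + (\<Sum>i\<in>{j..<m}. d i)"
    using assms(4) by (metis sum.atLeastLessThan_concat atLeast0LessThan le0)
  moreover have "(\<Sum>i\<in>{j..<m}. d i) \<le> 0"
    using assms(2) False by (intro sum_nonpos) auto
  ultimately show ?thesis using assms(3) by simp
qed

text \<open>
  Interchanging even and odd heights replaces the choice of a root among the \<open>k\<close> even vertices by
  a choice among the \<open>n - k\<close> odd ones.
\<close>

lemma weight_reflect:
  assumes "n \<ge> 1" "k \<le> n"
  shows "real k * even_height_weight n (n - k) = real (n - k) * even_height_weight n k"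
proof (cases "k = 0 \<or> k = n")
  case True
  then show ?thesis using assms by (auto simp: even_height_weight_def)
next
  case False
  then obtain a b where ab: "k = Suc a" "n - k = Suc b" using assms by (cases k; cases "n - k") auto
  then have n: "n = Suc a + Suc b" using assms by simp
  have "n choose Suc b = n choose Suc a" unfolding n
    by (subst binomial_symmetric) auto
  then show ?thesis unfolding ab
    by (simp add: even_height_weight_def n del: binomial_Suc_Suc)
qed

lemma weight_nonneg: "even_height_weight n k \<ge> 0"
  by (simp add: even_height_weight_def)

lemma weight_reflect_le:
  assumes "n \<ge> 1" "2 * i \<le> n"
  shows "even_height_weight n i \<le> even_height_weight n (n - i)"
proof (cases "i = 0")
  case True
  then show ?thesis using assms by (cases n) (auto simp: even_height_weight_def)
next
  case False
  have "real i * even_height_weight n i \<le> real (n - i) * even_height_weight n i"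
    using assms weight_nonneg by (intro mult_right_mono) auto
  also have "\<dots> = real i * even_height_weight n (n - i)"
    using assms by (simp add: weight_reflect)
  finally show ?thesis using False by simp
qed

text \<open>
  Let \<open>c = n - 1 - i\<close>, so that \<open>i \<le> c\<close>. The binomial coefficients increase from \<open>i\<close> to \<open>i + 1\<close>, and the
  powers compare because \<open>(1 + 1/c)\<^bsup>i\<^esup> \<le> (1 + 1/i)\<^bsup>c\<^esup>\<close> for \<open>i > 0\<close>: the left-hand side has the smaller base
  and the smaller exponent.
\<close>

lemma weight_shift_le:
  assumes "n \<ge> 1" "2 * i + 1 \<le> n"
  shows "even_height_weight n (n - i) \<le> even_height_weight n (Suc i)"
proof -
  define c where "c = n - 1 - i"
  have n: "n = i + c + 1" and ic: "i \<le> c" using assms by (auto simp: c_def)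
  have pow: "real (c + 1) ^ i * real i ^ c \<le> real c ^ i * real (i + 1) ^ c"
  proof (cases "i = 0")
    case True then show ?thesis by (cases c) auto
  next
    case False
    have "(real (c + 1) / c) ^ i \<le> (real (i + 1) / i) ^ i"
      using False ic by (intro power_mono) (auto simp: field_simps)
    also have "\<dots> \<le> (real (i + 1) / i) ^ c"
      using False ic by (intro power_increasing) auto
    finally show ?thesis using False ic by (simp add: power_divide field_simps)
  qed
  have "Suc i * (n choose Suc i) = (c + 1) * (n choose i)"
    using Suc_times_binomial_eq[of n i] binomial_absorb_comp[of "Suc n" i]
    unfolding n by (simp add: algebra_simps)
  then have "Suc i * (n choose i) \<le> Suc i * (n choose Suc i)"
    using ic by (metis Suc_eq_plus1 Suc_le_mono mult_le_mono1)
  then have "real (n choose i) \<le> real (n choose Suc i)"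
    by (simp only: mult_le_cancel1 of_nat_le_iff)
  then have "real (n choose i) * (real (c + 1) ^ i * real i ^ c)
      \<le> real (n choose Suc i) * (real c ^ i * real (i + 1) ^ c)"
    using pow by (rule_tac mult_mono) auto
  moreover have "n choose (n - i) = n choose i"
    by (rule binomial_symmetric[symmetric]) (use n in simp)
  ultimately show ?thesis
    by (simp add: even_height_weight_def n mult_ac)
qed

text \<open>
  The terms are nonnegative for \<open>2 i \<le> n\<close>, nonpositive afterwards, and cancel in total.
\<close>

lemma reflection_excess_nonneg:
  assumes n: "n \<ge> 1" and j: "j \<le> n"
  shows "0 \<le> (\<Sum>i\<le>j. even_height_weight n (n - i) - even_height_weight n i)"
proof -
  have "0 \<le> (\<Sum>i<Suc j. even_height_weight n (n - i) - even_height_weight n i)"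
  proof (rule partial_sums_nonneg_if_sign_change[where m = "Suc n" and c = "n div 2 + 1"])
    fix i assume "i < Suc n" "i < n div 2 + 1"
    then show "0 \<le> even_height_weight n (n - i) - even_height_weight n i"
      using weight_reflect_le[OF n, of i] by simp
  next
    fix i assume "i < Suc n" "n div 2 + 1 \<le> i"
    then show "even_height_weight n (n - i) - even_height_weight n i \<le> 0"
      using weight_reflect_le[OF n, of "n - i"] by simp
  next
    have "(\<Sum>i<Suc n. even_height_weight n (n - i)) = (\<Sum>i<Suc n. even_height_weight n i)"
      by (rule sum.reindex_bij_witness[of _ "\<lambda>i. n - i" "\<lambda>i. n - i"]) auto
    then show "(\<Sum>i<Suc n. even_height_weight n (n - i) - even_height_weight n i) = 0"
      by (simp add: sum_subtractf)
  qed (use j in simp)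
  then show ?thesis by (simp add: lessThan_Suc_atMost)
qed

text \<open>
  Shifting the index in one of the two sums writes the difference of both sides as a partial sum of
  \<open>w (i + 1) - w (n - i)\<close>. This sequence is antisymmetric under \<open>i \<mapsto> n - 1 - i\<close>, with nonnegative terms
  in its first half.
\<close>

lemma reflection_excess_le:
  assumes n: "n \<ge> 1" and j: "j \<le> n"
  shows "(\<Sum>i\<le>j. even_height_weight n (n - i) - even_height_weight n i) \<le> even_height_weight n (n - j)"
proof -
  have "0 \<le> (\<Sum>i<j. even_height_weight n (Suc i) - even_height_weight n (n - i))"
  proof (rule partial_sums_nonneg_if_sign_change[where m = n and c = "(n + 1) div 2"])
    fix i assume "i < n" "i < (n + 1) div 2"
    then show "0 \<le> even_height_weight n (Suc i) - even_height_weight n (n - i)"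
      using weight_shift_le[OF n, of i] by simp
  next
    fix i assume i: "i < n" "(n + 1) div 2 \<le> i"
    then have "2 * (n - 1 - i) + 1 \<le> n" "n - (n - 1 - i) = Suc i" "Suc (n - 1 - i) = n - i" by auto
    then show "even_height_weight n (Suc i) - even_height_weight n (n - i) \<le> 0"
      using weight_shift_le[OF n, of "n - 1 - i"] by simp
  next
    have "(\<Sum>i<n. even_height_weight n (n - i)) = (\<Sum>i<n. even_height_weight n (Suc i))"
      by (rule sum.reindex_bij_witness[of _ "\<lambda>i. n - Suc i" "\<lambda>i. n - Suc i"]) (auto simp: Suc_diff_Suc)
    then show "(\<Sum>i<n. even_height_weight n (Suc i) - even_height_weight n (n - i)) = 0"
      by (simp add: sum_subtractf)
  qed (use j in simp)
  moreover have "even_height_weight n 0 = 0"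
    using n by (simp add: even_height_weight_def)
  ultimately show ?thesis
    unfolding sum_subtractf lessThan_Suc_atMost[symmetric]
    by (subst (2) sum.lessThan_Suc_shift) simp
qed

text \<open>
  Given \<open>g\<close>, the bit is set with conditional probability \<open>e (n - g) / p g\<close>. Adding the bit moves the
  mass \<open>e j\<close> from \<open>j\<close> to \<open>j + 1\<close>, so the mass at \<open>j\<close> changes by \<open>e (j - 1) - e j\<close>, which is exactly the
  difference between \<open>p j\<close> and the reflected mass \<open>p (n - j)\<close>.
\<close>

lemma exists_reflection_coupling:
  fixes p :: "nat pmf" and n :: nat
  defines "e \<equiv> \<lambda>j. \<Sum>i\<le>j. pmf p (n - i) - pmf p i"
  assumes supp: "set_pmf p \<subseteq> {..n}"
    and nonneg: "\<And>j. j \<le> n \<Longrightarrow> 0 \<le> e j" and le: "\<And>j. j \<le> n \<Longrightarrow> e j \<le> pmf p (n - j)"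
  shows "\<exists>J :: (nat \<times> bool) pmf. map_pmf fst J = p \<and> map_pmf (\<lambda>(g, b). n - g + of_bool b) J = p"
proof -
  define r where "r g = e (n - g) / pmf p g" for g
  define J where "J = p \<bind> (\<lambda>g. map_pmf (Pair g) (bernoulli_pmf (r g)))"
  have r: "0 \<le> r g" "r g \<le> 1" "r g * pmf p g = e (n - g)" if "g \<le> n" for g
    using nonneg[of "n - g"] le[of "n - g"] that pmf_nonneg[of p g]
    by (auto simp: r_def divide_simps)
  have "map_pmf fst J = p"
    unfolding J_def map_bind_pmf map_pmf_comp by (simp add: bind_return_pmf')
  moreover have "map_pmf (\<lambda>(g, b). n - g + of_bool b) J = p"
  proof (rule pmf_eqI)
    fix k
    have outside: "pmf p k = 0" if "k > n" for k
      using supp that by (meson atMost_iff leD set_pmf_iff subsetD)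
    have "pmf (map_pmf (\<lambda>(g, b). n - g + of_bool b) J) k
      = measure_pmf.expectation p (\<lambda>g. pmf (map_pmf (\<lambda>b. n - g + of_bool b) (bernoulli_pmf (r g))) k)"
      unfolding J_def map_bind_pmf map_pmf_comp pmf_bind by simp
    also have "\<dots> = (\<Sum>g\<le>n. pmf (map_pmf (\<lambda>b. n - g + of_bool b) (bernoulli_pmf (r g))) k * pmf p g)"
      using supp by (intro integral_measure_pmf_real) auto
    also have "\<dots> = (\<Sum>g\<le>n. of_bool (k = n - g) * (pmf p g - e (n - g)) + of_bool (k = Suc (n - g)) * e (n - g))"
    proof (rule sum.cong[OF refl])
      fix g assume "g \<in> {..n}"
      then have g: "g \<le> n" by simp
      have A: "pmf (map_pmf (\<lambda>b. n - g + of_bool b) (bernoulli_pmf (r g))) k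
        = of_bool (k = Suc (n - g)) * r g + of_bool (k = n - g) * (1 - r g)"
        unfolding map_pmf_def pmf_bind using r(1,2)[OF g]
        by (subst integral_bernoulli_pmf) (auto simp: indicator_def)
      have "(a * t + b * (1 - t)) * c = b * (c - t * c) + a * (t * c)" for a b c t :: real
        by (simp add: algebra_simps)
      then show "pmf (map_pmf (\<lambda>b. n - g + of_bool b) (bernoulli_pmf (r g))) k * pmf p g
        = of_bool (k = n - g) * (pmf p g - e (n - g)) + of_bool (k = Suc (n - g)) * e (n - g)"
        unfolding A r(3)[OF g, symmetric] .
    qed
    also have "\<dots> = (\<Sum>j\<le>n. of_bool (k = j) * (pmf p (n - j) - e j) + of_bool (k = Suc j) * e j)"
      by (rule sum.reindex_bij_witness[of _ "\<lambda>i. n - i" "\<lambda>i. n - i"]) auto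
    also have "\<dots> = (\<Sum>j\<le>n. if k = j then pmf p (n - j) - e j else 0) + (\<Sum>j\<le>n. if k = Suc j then e j else 0)"
      unfolding sum.distrib[symmetric] by (intro sum.cong) auto
    also have "\<dots> = (if k \<le> n then pmf p (n - k) - e k else 0) + (if k > 0 \<and> k \<le> Suc n then e (k - 1) else 0)"
    proof -
      have "(\<Sum>j\<le>n. if k = Suc j then e j else 0) = (if k > 0 \<and> k \<le> Suc n then e (k - 1) else 0)"
        by (cases k) (auto simp: sum.delta')
      then show ?thesis by (simp add: sum.delta')
    qed
    also have "\<dots> = pmf p k"
    proof (cases k)
      case 0
      then show ?thesis by (simp add: e_def)
    next
      case (Suc i)
      have "e n = 0"
      proof -
        have "(\<Sum>i\<le>n. pmf p (n - i)) = (\<Sum>i\<le>n. pmf p i)"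
          by (rule sum.reindex_bij_witness[of _ "\<lambda>i. n - i" "\<lambda>i. n - i"]) auto
        then show ?thesis by (simp add: e_def sum_subtractf)
      qed
      moreover have "e (Suc i) = e i + (pmf p (n - Suc i) - pmf p (Suc i))" by (simp add: e_def)
      ultimately show ?thesis
        using Suc outside[of k] by (cases "i < n"; cases "i = n") auto
    qed
    finally show "pmf (map_pmf (\<lambda>(g, b). n - g + of_bool b) J) k = pmf p k" .
  qed
  ultimately show ?thesis by blast
qed

text \<open>
  Both sides are the difference of the means of \<open>g\<close> and \<open>n - g\<close>.
\<close>

lemma reflection_coupling_prob:
  fixes J :: "(nat \<times> bool) pmf"
  assumes J: "map_pmf fst J = p" "map_pmf (\<lambda>(g, b). n - g + of_bool b) J = p"
    and supp: "set_pmf p \<subseteq> {..n}"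
  shows "measure_pmf.prob J {x. snd x} = (\<Sum>g\<le>n. (2 * real g - n) * pmf p g)"
proof -
  have le: "fst x \<le> n" if "x \<in> set_pmf J" for x
    using supp that J(1) by (metis atMost_iff imageI in_mono set_map_pmf)
  have "set_pmf J \<subseteq> {..n} \<times> UNIV" using le by auto
  then have "finite (set_pmf J)" by (rule finite_subset) simp
  then have int: "integrable (measure_pmf J) f" for f :: "nat \<times> bool \<Rightarrow> real"
    by (rule integrable_measure_pmf_finite)
  have finp: "finite (set_pmf p)" using supp finite_subset by blast
  have intp: "integrable (measure_pmf p) f" for f :: "nat \<Rightarrow> real"
    using finp by (rule integrable_measure_pmf_finite)
  have "measure_pmf.prob J {x. snd x} = measure_pmf.expectation J (indicator {x. snd x})"
    by simp
  also have "\<dots> = measure_pmf.expectation J (\<lambda>x. real (case x of (g, b) \<Rightarrow> n - g + of_bool b) + real (fst x) - n)"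
    using le by (intro integral_cong_AE) (auto simp: AE_measure_pmf_iff indicator_def of_nat_diff)
  also have "\<dots> = measure_pmf.expectation J (\<lambda>x. real (case x of (g, b) \<Rightarrow> n - g + of_bool b))
      + measure_pmf.expectation J (\<lambda>x. real (fst x)) - n"
    by (simp add: int Bochner_Integration.integral_add Bochner_Integration.integral_diff)
  also have "measure_pmf.expectation J (\<lambda>x. real (case x of (g, b) \<Rightarrow> n - g + of_bool b)) = measure_pmf.expectation p real"
    by (subst J(2)[symmetric]) (simp only: integral_map_pmf)
  also have "measure_pmf.expectation J (\<lambda>x. real (fst x)) = measure_pmf.expectation p real"
    by (subst J(1)[symmetric]) (simp only: integral_map_pmf)
  also have "measure_pmf.expectation p real + measure_pmf.expectation p real - n
    = measure_pmf.expectation p (\<lambda>g. 2 * real g - n)"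
    by (simp add: intp Bochner_Integration.integral_diff)
  also have "\<dots> = (\<Sum>g\<le>n. (2 * real g - n) * pmf p g)"
    using supp by (intro integral_measure_pmf_real) auto
  finally show ?thesis .
qed

lemma greedy_reflection_coupling:
  assumes n: "n \<ge> 1"
  shows "\<exists>J :: (nat \<times> bool) pmf. map_pmf fst J = greedy_size_law n
    \<and> map_pmf (\<lambda>(g, b). n - g + of_bool b) J = greedy_size_law n
    \<and> (\<forall>x\<in>set_pmf J. fst x \<le> n)
    \<and> measure_pmf.prob J {x. snd x} = n * (1 - 2 * alternating_falling_sum n)"
proof -
  let ?p = "greedy_size_law n"
  note pmf = pmf_greedy_size_law[OF n]
  have supp: "set_pmf ?p \<subseteq> {..n}"
  proof
    fix k assume "k \<in> set_pmf ?p"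
    then have "even_height_weight n k \<noteq> 0" using pmf[of k] by (auto simp: set_pmf_iff)
    then show "k \<in> {..n}" by (auto simp: even_height_weight_def)
  qed
  have e: "(\<Sum>i\<le>j. pmf ?p (n - i) - pmf ?p i)
      = (\<Sum>i\<le>j. even_height_weight n (n - i) - even_height_weight n i) / real n ^ (n - 1)" for j
    unfolding pmf by (simp add: sum_divide_distrib diff_divide_distrib)
  have nonneg: "0 \<le> (\<Sum>i\<le>j. pmf ?p (n - i) - pmf ?p i)" if "j \<le> n" for j
    unfolding e using reflection_excess_nonneg[OF n that] by simp
  have le: "(\<Sum>i\<le>j. pmf ?p (n - i) - pmf ?p i) \<le> pmf ?p (n - j)" if "j \<le> n" for j
    unfolding e unfolding pmf using reflection_excess_le[OF n that] by (intro divide_right_mono) auto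
  obtain J :: "(nat \<times> bool) pmf" where J: "map_pmf fst J = ?p" "map_pmf (\<lambda>(g, b). n - g + of_bool b) J = ?p"
    using exists_reflection_coupling[OF supp nonneg le] by blast
  have "fst x \<le> n" if "x \<in> set_pmf J" for x
    using supp that J(1) by (metis atMost_iff imageI in_mono set_map_pmf)
  moreover have "measure_pmf.prob J {x. snd x} = n * (1 - 2 * alternating_falling_sum n)"
    unfolding reflection_coupling_prob[OF J supp] pmf by (rule mean_imbalance[OF n])
  ultimately show ?thesis using J by blast
qed

section \<open>The limit of the mean imbalance\<close>

text \<open>
  The numbers \<open>q h\<close> of the introduction, continued by \<open>0\<close> so that differences have no boundary term at
  \<open>h = n\<close>.
\<close>

definition falling_ratio :: "nat \<Rightarrow> nat \<Rightarrow> real" where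
  "falling_ratio n h = (if h \<le> n then fact n / fact (n - h) / real n ^ h else 0)"

text \<open>
  This relation is used in both directions: it computes differences, and it turns moments of
  \<open>falling_ratio n\<close> into telescoping sums.
\<close>

lemma falling_ratio_diff:
  assumes "n \<ge> 1"
  shows "falling_ratio n h - falling_ratio n (Suc h) = real h / n * falling_ratio n h"
proof -
  consider "h < n" | "h = n" | "h > n" by linarith
  then show ?thesis
  proof cases
    case 1
    then have "n - h = Suc (n - Suc h)" by simp
    then have "(fact (n - h) :: real) = real (n - h) * fact (n - Suc h)" by simp
    then have *: "(fact n :: real) / fact (n - Suc h) = real (n - h) * (fact n / fact (n - h))"
      using 1 by simp
    have "falling_ratio n (Suc h) = real (n - h) / n * falling_ratio n h"
      using 1 assms unfolding falling_ratio_def * by simp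
    then show ?thesis using 1 assms by (simp add: of_nat_diff field_simps)
  qed (use assms in \<open>auto simp: falling_ratio_def\<close>)
qed

lemma falling_ratio_Suc:
  assumes "n \<ge> 1"
  shows "falling_ratio n (Suc h) = (1 - real h / n) * falling_ratio n h"
  using falling_ratio_diff[OF assms, of h] by (simp add: algebra_simps)

lemma falling_ratio_nonneg: "falling_ratio n h \<ge> 0"
  by (simp add: falling_ratio_def)

lemma falling_ratio_0: "falling_ratio n 0 = 1"
  by (simp add: falling_ratio_def)

lemma falling_ratio_eq_0: "h > n \<Longrightarrow> falling_ratio n h = 0"
  by (simp add: falling_ratio_def)

text \<open>
  One step of Euler summation.
\<close>

lemma alternating_sum_differences:
  fixes a :: "nat \<Rightarrow> real"
  assumes "a (Suc N) = 0"
  shows "(\<Sum>h\<le>N. (-1) ^ h * a h) = a 0 / 2 + (\<Sum>h\<le>N. (-1) ^ h * (a h - a (Suc h))) / 2"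
proof -
  have "(\<Sum>h\<le>N. (-1) ^ h * a (Suc h)) = a 0 - (\<Sum>h\<le>Suc N. (-1) ^ h * a h)"
    by (subst sum.atMost_Suc_shift) (simp add: sum_negf)
  also have "(\<Sum>h\<le>Suc N. (-1) ^ h * a h) = (\<Sum>h\<le>N. (-1) ^ h * a h)"
    using assms by simp
  finally have "(\<Sum>h\<le>N. (-1) ^ h * a (Suc h)) = a 0 - (\<Sum>h\<le>N. (-1) ^ h * a h)" .
  then show ?thesis by (simp add: right_diff_distrib sum_subtractf field_simps)
qed

text \<open>
  A factor \<open>h / n\<close> is traded for a difference of \<open>falling_ratio\<close>, and summation by parts moves the
  difference to the power. So two factors \<open>h\<close> are traded for one factor \<open>n\<close>.
\<close>

lemma moment_reduction:
  assumes "n \<ge> 1"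
  shows "(\<Sum>h\<le>n. real h ^ Suc j * falling_ratio n h)
       = n * (\<Sum>h\<in>{1..n}. (real h ^ j - real (h - 1) ^ j) * falling_ratio n h)
         + (if j = 0 then real n else 0)"
proof -
  have "(\<Sum>h\<le>n. real h ^ Suc j * falling_ratio n h)
      = n * (\<Sum>h\<le>n. real h ^ j * (falling_ratio n h - falling_ratio n (Suc h)))"
    unfolding falling_ratio_diff[OF assms] sum_distrib_left
    using assms by (intro sum.cong) auto
  also have "(\<Sum>h\<le>n. real h ^ j * (falling_ratio n h - falling_ratio n (Suc h)))
     = (\<Sum>h\<le>n. real h ^ j * falling_ratio n h) - (\<Sum>h\<le>n. real h ^ j * falling_ratio n (Suc h))"
    by (simp add: algebra_simps sum_subtractf)
  also have "(\<Sum>h\<le>n. real h ^ j * falling_ratio n (Suc h)) = (\<Sum>h\<in>{1..n}. real (h - 1) ^ j * falling_ratio n h)"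
  proof -
    have "(\<Sum>h\<le>n. real h ^ j * falling_ratio n (Suc h)) = (\<Sum>h\<in>{1..Suc n}. real (h - 1) ^ j * falling_ratio n h)"
      by (rule sum.reindex_bij_witness[of _ "\<lambda>h. h - 1" Suc]) auto
    then show ?thesis by (simp add: falling_ratio_eq_0)
  qed
  also have "(\<Sum>h\<le>n. real h ^ j * falling_ratio n h)
      = (if j = 0 then 1 else 0) + (\<Sum>h\<in>{1..n}. real h ^ j * falling_ratio n h)"
  proof -
    have "{..n} = insert 0 {1..n}" by auto
    then show ?thesis by (simp add: falling_ratio_0 power_0_left)
  qed
  finally show ?thesis by (simp add: algebra_simps sum_subtractf)
qed

definition ratio_mass :: "nat \<Rightarrow> real" where
  "ratio_mass n = (\<Sum>h\<le>n. falling_ratio n h)"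

lemma second_moment_le:
  assumes "n \<ge> 1"
  shows "(\<Sum>h\<le>n. real h ^ 2 * falling_ratio n h) \<le> n * ratio_mass n"
proof -
  have "(\<Sum>h\<le>n. real h ^ 2 * falling_ratio n h) = n * (\<Sum>h\<in>{1..n}. (real h ^ 1 - real (h - 1) ^ 1) * falling_ratio n h)"
    using moment_reduction[OF assms, of 1] by (simp add: numeral_2_eq_2)
  also have "\<dots> = n * (\<Sum>h\<in>{1..n}. falling_ratio n h)"
    by (intro arg_cong2[where f = "(*)"] sum.cong refl) (auto simp: of_nat_diff)
  also have "\<dots> \<le> n * ratio_mass n"
    unfolding ratio_mass_def
    by (intro mult_left_mono sum_mono2) (auto simp: falling_ratio_nonneg)
  finally show ?thesis .
qed

lemma fourth_moment_le:
  assumes "n \<ge> 1"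
  shows "(\<Sum>h\<le>n. real h ^ 4 * falling_ratio n h) \<le> 3 * real n ^ 2 * ratio_mass n"
proof -
  have "(\<Sum>h\<le>n. real h ^ 4 * falling_ratio n h) = n * (\<Sum>h\<in>{1..n}. (real h ^ 3 - real (h - 1) ^ 3) * falling_ratio n h)"
    using moment_reduction[OF assms, of 3] by (simp add: eval_nat_numeral)
  also have "\<dots> \<le> n * (\<Sum>h\<in>{1..n}. 3 * (real h ^ 2 * falling_ratio n h))"
  proof (intro mult_left_mono sum_mono)
    fix h assume "h \<in> {1..n}"
    then obtain i where h: "h = Suc i" by (cases h) auto
    have "real h ^ 3 - real (h - 1) ^ 3 \<le> 3 * real h ^ 2"
      unfolding h by (simp add: eval_nat_numeral algebra_simps)
    then show "(real h ^ 3 - real (h - 1) ^ 3) * falling_ratio n h \<le> 3 * (real h ^ 2 * falling_ratio n h)"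
      using mult_right_mono[OF _ falling_ratio_nonneg] by (fastforce simp: mult.assoc)
  qed auto
  also have "\<dots> \<le> n * (3 * (\<Sum>h\<le>n. real h ^ 2 * falling_ratio n h))"
    unfolding sum_distrib_left[symmetric]
    by (intro mult_left_mono sum_mono2) (auto simp: falling_ratio_nonneg)
  also have "\<dots> \<le> n * (3 * (n * ratio_mass n))"
    using second_moment_le[OF assms] by (intro mult_left_mono) auto
  finally show ?thesis by (simp add: power2_eq_square algebra_simps)
qed

text \<open>
  Terms with \<open>h < K\<close> are at most \<open>1\<close>; the others are at most \<open>h / K\<close> times themselves, and the first
  moment is \<open>n\<close>. The best choice \<open>K \<approx> \<surd>n\<close> shows that the mass is at most of order \<open>\<surd>n\<close>.
\<close>

lemma ratio_mass_le:
  assumes "n \<ge> 1" "K > 0"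
  shows "ratio_mass n \<le> real K + real n / K"
proof -
  have le1: "falling_ratio n h \<le> 1" for h
  proof (induction h)
    case (Suc h)
    have "falling_ratio n (Suc h) \<le> falling_ratio n h"
      using falling_ratio_diff[OF assms(1), of h] falling_ratio_nonneg[of n h]
      by (smt (verit) divide_nonneg_nonneg mult_nonneg_nonneg of_nat_0_le_iff)
    then show ?case using Suc by simp
  qed (simp add: falling_ratio_0)
  have "ratio_mass n \<le> (\<Sum>h\<le>n. (if h < K then 1 else 0) + real h / K * falling_ratio n h)"
    unfolding ratio_mass_def
  proof (rule sum_mono)
    fix h
    show "falling_ratio n h \<le> (if h < K then 1 else 0) + real h / K * falling_ratio n h"
    proof (cases "h < K")
      case True
      then show ?thesis using le1[of h] falling_ratio_nonneg[of n h] by (simp add: add_increasing2)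
    next
      case False
      then have "1 * falling_ratio n h \<le> real h / K * falling_ratio n h"
        using assms by (intro mult_right_mono falling_ratio_nonneg) auto
      then show ?thesis using False by simp
    qed
  qed
  also have "\<dots> = real (card ({..n} \<inter> {h. h < K})) + (\<Sum>h\<le>n. real h ^ Suc 0 * falling_ratio n h) / K"
    by (simp add: sum.distrib sum_divide_distrib sum.If_cases)
  also have "(\<Sum>h\<le>n. real h ^ Suc 0 * falling_ratio n h) = n"
    using moment_reduction[OF assms(1), of 0] by simp
  also have "card ({..n} \<inter> {h. h < K}) \<le> card {..<K}"
    by (intro card_mono) auto
  finally show ?thesis by simp
qed

lemma ratio_mass_sublinear: "(\<lambda>n. ratio_mass n / n) \<longlonglongrightarrow> 0"
proof (rule tendsto_sandwich[OF _ _ tendsto_const])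
  show "\<forall>\<^sub>F n in sequentially. 0 \<le> ratio_mass n / n"
    by (intro always_eventually) (auto simp: ratio_mass_def falling_ratio_nonneg sum_nonneg)
  show "\<forall>\<^sub>F n in sequentially. ratio_mass n / n \<le> (sqrt n + 1) / n + 1 / sqrt n"
  proof (rule eventually_sequentiallyI[of 1])
    fix n :: nat assume n: "n \<ge> 1"
    define K where "K = nat \<lceil>sqrt n\<rceil>"
    have K: "sqrt n \<le> K" "real K \<le> sqrt n + 1"
      unfolding K_def using real_sqrt_ge_zero[of "real n"] by linarith+
    have sq: "sqrt n \<ge> 1" using n by simp
    then have K0: "K > 0" using K by linarith
    then have "ratio_mass n \<le> real K + real n / K" using ratio_mass_le[OF n] by simp
    also have "\<dots> \<le> (sqrt n + 1) + real n / sqrt n"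
      using K sq K0 n by (intro add_mono divide_left_mono) (auto intro!: mult_pos_pos)
    finally have "ratio_mass n / n \<le> ((sqrt n + 1) + real n / sqrt n) / n"
      by (intro divide_right_mono) auto
    also have "\<dots> = (sqrt n + 1) / n + 1 / sqrt n"
      using n by (simp add: add_divide_distrib)
    finally show "ratio_mass n / n \<le> (sqrt n + 1) / n + 1 / sqrt n" .
  qed
  show "(\<lambda>n. (sqrt (real n) + 1) / n + 1 / sqrt n) \<longlonglongrightarrow> 0"
    by real_asymp
qed

text \<open>
  The function \<open>e\<close> is the second difference of \<open>h q h\<close>. One more difference gains enough powers
  of \<open>1 / n\<close> for absolute convergence: by the moment bounds, each of the three terms
  sums to at most a constant times \<open>(\<Sum>h. q h) / n\<close>.
\<close>

lemma third_difference_bound: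
  assumes "n \<ge> 1"
  defines "a \<equiv> \<lambda>h. h * (h + 1) * (h + 2) / real n ^ 2 - (3 * h + 2) / n"
  defines "e \<equiv> \<lambda>h. falling_ratio n h * a (real h)"
  shows "\<bar>e h - e (Suc h)\<bar> \<le> (20 / n + 40 * real h ^ 2 / real n ^ 2 + 24 * real h ^ 4 / real n ^ 3) * falling_ratio n h"
proof -
  have "e h - e (Suc h) = (a h - (1 - real h / n) * a (real h + 1)) * falling_ratio n h"
    unfolding e_def falling_ratio_Suc[OF assms(1)] by (simp add: algebra_simps)
  also have "a h - (1 - real h / n) * a (real h + 1)
    = 3 / n - 3 * (real h + 1) * (real h + 2) / real n ^ 2 - h * (3 * real h + 5) / real n ^ 2
      + real h * (real h + 1) * (real h + 2) * (real h + 3) / real n ^ 3"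
    using assms(1) unfolding a_def
    by (simp add: divide_simps) (simp add: eval_nat_numeral algebra_simps)
  finally have eq: "e h - e (Suc h) = (3 / n - 3 * (real h + 1) * (real h + 2) / real n ^ 2 - h * (3 * real h + 5) / real n ^ 2
      + real h * (real h + 1) * (real h + 2) * (real h + 3) / real n ^ 3) * falling_ratio n h" .
  have "\<bar>3 / n - 3 * (real h + 1) * (real h + 2) / real n ^ 2 - h * (3 * real h + 5) / real n ^ 2
      + real h * (real h + 1) * (real h + 2) * (real h + 3) / real n ^ 3\<bar>
    \<le> 20 / n + 40 * real h ^ 2 / real n ^ 2 + 24 * real h ^ 4 / real n ^ 3"
  proof (cases "h = 0")
    case True
    have "6 / real n ^ 2 \<le> 6 / n" using assms(1) by (simp add: field_simps power2_eq_square)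
    moreover have "0 \<le> 6 / real n ^ 2" "0 \<le> 3 / real n" "3 / real n \<le> 20 / n" "6 / real n \<le> 20 / n"
      by (auto intro!: divide_right_mono)
    ultimately have "\<bar>3 / real n - 6 / real n ^ 2\<bar> \<le> 20 / n" by linarith
    then show ?thesis using True by simp
  next
    case False
    then have h: "real h \<ge> 1" by simp
    have 1: "3 * (real h + 1) * (real h + 2) + h * (3 * real h + 5) \<le> 40 * real h ^ 2"
    proof -
      have "real h \<le> real h ^ 2" "1 \<le> real h ^ 2" using h by (auto intro: self_le_power one_le_power)
      then show ?thesis by (simp add: algebra_simps power2_eq_square) 
    qed
    have 2: "real h * (real h + 1) * (real h + 2) * (real h + 3) \<le> 24 * real h ^ 4"
    proof -
      have "real h * (real h + 1) * (real h + 2) * (real h + 3) \<le> real h * (2 * real h) * (3 * real h) * (4 * real h)"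
        using h by (intro mult_mono) auto
      then show ?thesis by (simp add: eval_nat_numeral)
    qed
    have "3 * (real h + 1) * (real h + 2) / real n ^ 2 + h * (3 * real h + 5) / real n ^ 2 \<le> 40 * real h ^ 2 / real n ^ 2"
      using 1 by (metis add_divide_distrib divide_right_mono of_nat_0_le_iff of_nat_power)
    moreover have "real h * (real h + 1) * (real h + 2) * (real h + 3) / real n ^ 3 \<le> 24 * real h ^ 4 / real n ^ 3"
      using 2 by (intro divide_right_mono) auto
    moreover have "0 \<le> 3 * (real h + 1) * (real h + 2) / real n ^ 2" "0 \<le> h * (3 * real h + 5) / real n ^ 2"
      "0 \<le> real h * (real h + 1) * (real h + 2) * (real h + 3) / real n ^ 3" "0 \<le> 3 / real n" "3 / real n \<le> 20 / n"
      by (auto intro!: divide_right_mono)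
    ultimately show ?thesis by linarith
  qed
  then show ?thesis unfolding eq abs_mult
    by (metis abs_of_nonneg falling_ratio_nonneg mult_right_mono)
qed

text \<open>
  One Euler summation removes the factor \<open>n\<close> and leaves the sum of \<open>(-1)\<^bsup>h+1\<^esup> h q h\<close>. Three further
  ones produce the boundary terms \<open>1/4 + 1 / (4 n)\<close> and a remainder controlled by
  \<open>third_difference_bound\<close>.
\<close>

lemma alternating_falling_sum_asymptotics:
  "(\<lambda>n. n * (1 - 2 * alternating_falling_sum n)) \<longlonglongrightarrow> 1 / 4"
proof -
  define err where "err n = n * (1 - 2 * alternating_falling_sum n) - 1 / 4 - 1 / (4 * real n)" for n :: nat
  have bound: "\<bar>err n\<bar> \<le> 17 * (ratio_mass n / n)" if n: "n \<ge> 1" for n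
  proof -
    let ?q = "falling_ratio n"
    define a where "a h = h * (h + 1) * (h + 2) / real n ^ 2 - (3 * h + 2) / n" for h :: real
    define b where "b h = h * (h + 1) / n - 1" for h :: real
    let ?A = "\<lambda>f. \<Sum>h\<le>n. (-1) ^ h * f h"
    have a0: "a 0 = - (2 / n)" and b0: "b 0 = - 1" by (simp_all add: a_def b_def)
    have q0: "?q (Suc n) = 0" by (simp add: falling_ratio_eq_0)
    have "alternating_falling_sum n = ?A ?q"
      unfolding alternating_falling_sum_def falling_ratio_def by (intro sum.cong) auto
    also have "\<dots> = 1 / 2 + ?A (\<lambda>h. ?q h - ?q (Suc h)) / 2"
      using alternating_sum_differences[of ?q n, OF q0] by (simp add: falling_ratio_0)
    also have "?A (\<lambda>h. ?q h - ?q (Suc h)) = ?A (\<lambda>h. real h * ?q h) / n"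
      unfolding falling_ratio_diff[OF n] by (simp add: sum_divide_distrib mult_ac)
    finally have 1: "n * (1 - 2 * alternating_falling_sum n) = - ?A (\<lambda>h. real h * ?q h)"
      using n by (simp add: field_simps)
    have "?A (\<lambda>h. real h * ?q h) = ?A (\<lambda>h. real h * ?q h - real (Suc h) * ?q (Suc h)) / 2"
      using alternating_sum_differences[of "\<lambda>h. real h * ?q h" n] q0 by simp
    also have "(\<lambda>h. real h * ?q h - real (Suc h) * ?q (Suc h)) = (\<lambda>h. ?q h * b h)"
      unfolding falling_ratio_Suc[OF n] b_def using n by (auto simp: field_simps)
    also have "?A (\<lambda>h. ?q h * b h) = b 0 / 2 + ?A (\<lambda>h. ?q h * b h - ?q (Suc h) * b (Suc h)) / 2"
      using alternating_sum_differences[of "\<lambda>h. ?q h * b h" n] q0 by (simp add: falling_ratio_0)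
    also have "(\<lambda>h. ?q h * b h - ?q (Suc h) * b (Suc h)) = (\<lambda>h. ?q h * a h)"
    proof
      fix h
      have "b h - (1 - real h / n) * b (Suc h) = a h"
        unfolding a_def b_def using n by (simp add: divide_simps) (simp add: eval_nat_numeral algebra_simps)
      then show "?q h * b h - ?q (Suc h) * b (Suc h) = ?q h * a h"
        unfolding falling_ratio_Suc[OF n] by (simp add: algebra_simps flip: \<open>_ = a h\<close>)
    qed
    also have "?A (\<lambda>h. ?q h * a h) = a 0 / 2 + ?A (\<lambda>h. ?q h * a h - ?q (Suc h) * a (Suc h)) / 2"
      using alternating_sum_differences[of "\<lambda>h. ?q h * a h" n] q0 by (simp add: falling_ratio_0)
    finally have 2: "?A (\<lambda>h. real h * ?q h)
        = (b 0 / 2 + (a 0 / 2 + ?A (\<lambda>h. ?q h * a h - ?q (Suc h) * a (Suc h)) / 2) / 2) / 2" .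
    have 3: "1 / (4 * real n) = (2 / real n) / 8" by simp
    have 4: "- ((- 1 / 2 + (- t / 2 + S / 2) / 2) / 2) - 1 / 4 - t / 8 = - (S / 8)" for S t :: real
      by (simp add: field_simps)
    have "err n = - (?A (\<lambda>h. ?q h * a h - ?q (Suc h) * a (Suc h)) / 8)"
      unfolding err_def 1 2 a0 b0 3 by (rule 4)
    then have "\<bar>err n\<bar> \<le> (\<Sum>h\<le>n. \<bar>(-1) ^ h * (?q h * a h - ?q (Suc h) * a (Suc h))\<bar>) / 8"
      by (simp add: sum_abs)
    also have "\<dots> \<le> (\<Sum>h\<le>n. (20 / n + 40 * real h ^ 2 / real n ^ 2 + 24 * real h ^ 4 / real n ^ 3) * ?q h) / 8"
      using third_difference_bound[OF n]
      by (intro divide_right_mono sum_mono) (auto simp: a_def abs_mult power_abs add_ac)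
    also have "(\<Sum>h\<le>n. (20 / n + 40 * real h ^ 2 / real n ^ 2 + 24 * real h ^ 4 / real n ^ 3) * ?q h)
      = 20 / n * ratio_mass n + 40 / real n ^ 2 * (\<Sum>h\<le>n. real h ^ 2 * ?q h) + 24 / real n ^ 3 * (\<Sum>h\<le>n. real h ^ 4 * ?q h)"
      unfolding ratio_mass_def sum_distrib_left sum.distrib[symmetric]
      by (intro sum.cong) (auto simp: algebra_simps)
    also have "\<dots> \<le> 20 / n * ratio_mass n + 40 / real n ^ 2 * (n * ratio_mass n) + 24 / real n ^ 3 * (3 * real n ^ 2 * ratio_mass n)"
      using second_moment_le[OF n] fourth_moment_le[OF n]
      by (intro add_mono mult_left_mono) auto
    also have "\<dots> = 132 * (ratio_mass n / n)"
      using n by (simp add: field_simps eval_nat_numeral)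
    finally show ?thesis
      using n by (simp add: ratio_mass_def sum_nonneg falling_ratio_nonneg)
  qed
  have "err \<longlonglongrightarrow> 0"
  proof (rule Lim_null_comparison)
    show "\<forall>\<^sub>F n in sequentially. norm (err n) \<le> 17 * (ratio_mass n / n)"
      using bound by (intro eventually_sequentiallyI[of 1]) auto
    show "(\<lambda>n. 17 * (ratio_mass n / n)) \<longlonglongrightarrow> 0"
      using tendsto_mult_right_zero[OF ratio_mass_sublinear] .
  qed
  then have "(\<lambda>n. err n + (1 / 4 + 1 / (4 * real n))) \<longlonglongrightarrow> 0 + (1 / 4 + 0)"
    by (intro tendsto_add tendsto_const \<open>err \<longlonglongrightarrow> 0\<close>) real_asymp
  then show ?thesis by (simp add: err_def)
qed

section \<open>Size of the greedy independent set and of its complement\<close>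

theorem theorem2:
  shows "\<exists>(M :: nat \<Rightarrow> real measure) (G :: nat \<Rightarrow> real \<Rightarrow> nat) (\<E> :: nat \<Rightarrow> real \<Rightarrow> nat).
    (\<forall>n\<ge>1.
       prob_space (M n) \<and>
       G n \<in> measurable (M n) (count_space UNIV) \<and>
       distr (M n) (count_space UNIV) (G n) = measure_pmf (greedy_size_law n) \<and>
       \<E> n \<in> measurable (M n) (count_space UNIV) \<and>
       (\<forall>\<omega>\<in>space (M n). \<E> n \<omega> \<in> {0, 1}) \<and>
       distr (M n) (count_space UNIV) (\<lambda>\<omega>. int (G n \<omega>)) =
         distr (M n) (count_space UNIV) (\<lambda>\<omega>. (int n - int (G n \<omega>)) + int (\<E> n \<omega>))) \<and>
    (\<lambda>n. measure (M n) {\<omega> \<in> space (M n). \<E> n \<omega> = 1}) \<longlonglongrightarrow> 1 / 4"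
proof -
  obtain J :: "nat \<Rightarrow> (nat \<times> bool) pmf" where J:
    "\<And>n. n \<ge> 1 \<Longrightarrow> map_pmf fst (J n) = greedy_size_law n"
    "\<And>n. n \<ge> 1 \<Longrightarrow> map_pmf (\<lambda>(g, b). n - g + of_bool b) (J n) = greedy_size_law n"
    "\<And>n x. n \<ge> 1 \<Longrightarrow> x \<in> set_pmf (J n) \<Longrightarrow> fst x \<le> n"
    "\<And>n. n \<ge> 1 \<Longrightarrow> measure_pmf.prob (J n) {x. snd x} = n * (1 - 2 * alternating_falling_sum n)"
    using greedy_reflection_coupling by metis
  \<comment> \<open>The coupling lives on pairs; an injective code transports it to the real line.\<close>
  define enc :: "nat \<times> bool \<Rightarrow> real" where "enc x = real (to_nat x)" for x
  define dec :: "real \<Rightarrow> nat \<times> bool" where "dec y = from_nat (nat \<lfloor>y\<rfloor>)" for y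
  have dec: "dec (enc x) = x" for x by (simp add: dec_def enc_def)
  define P where "P n = map_pmf enc (J n)" for n
  define M where "M n = measure_pmf (P n)" for n
  define G :: "nat \<Rightarrow> real \<Rightarrow> nat" where "G n y = fst (dec y)" for n y
  define E :: "nat \<Rightarrow> real \<Rightarrow> nat" where "E n y = of_bool (snd (dec y))" for n y
  have distr: "distr (M n) (count_space UNIV) f = measure_pmf (map_pmf (\<lambda>x. f (enc x)) (J n))"
    for n and f :: "real \<Rightarrow> 'b"
    unfolding M_def P_def map_pmf_rep_eq[symmetric] map_pmf_comp ..
  have "prob_space (M n) \<and>
       G n \<in> measurable (M n) (count_space UNIV) \<and>
       distr (M n) (count_space UNIV) (G n) = measure_pmf (greedy_size_law n) \<and>
       E n \<in> measurable (M n) (count_space UNIV) \<and>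
       (\<forall>\<omega>\<in>space (M n). E n \<omega> \<in> {0, 1}) \<and>
       distr (M n) (count_space UNIV) (\<lambda>\<omega>. int (G n \<omega>)) =
         distr (M n) (count_space UNIV) (\<lambda>\<omega>. (int n - int (G n \<omega>)) + int (E n \<omega>))"
    if n: "n \<ge> 1" for n
  proof (intro conjI)
    show "prob_space (M n)" unfolding M_def by (rule prob_space_measure_pmf)
    show "G n \<in> measurable (M n) (count_space UNIV)" "E n \<in> measurable (M n) (count_space UNIV)"
      by (simp_all add: M_def)
    show "distr (M n) (count_space UNIV) (G n) = measure_pmf (greedy_size_law n)"
      unfolding distr G_def dec J(1)[OF n, symmetric] ..
    show "\<forall>\<omega>\<in>space (M n). E n \<omega> \<in> {0, 1}" by (simp add: E_def)
    have "map_pmf (\<lambda>x. int (fst x)) (J n) = map_pmf int (greedy_size_law n)"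
      unfolding J(1)[OF n, symmetric] map_pmf_comp ..
    also have "\<dots> = map_pmf (\<lambda>x. int (case x of (g, b) \<Rightarrow> n - g + of_bool b)) (J n)"
      unfolding J(2)[OF n, symmetric] map_pmf_comp ..
    also have "\<dots> = map_pmf (\<lambda>x. (int n - int (fst x)) + int (of_bool (snd x))) (J n)"
      using J(3)[OF n] by (intro map_pmf_cong) (auto simp: of_nat_diff)
    finally show "distr (M n) (count_space UNIV) (\<lambda>\<omega>. int (G n \<omega>)) =
         distr (M n) (count_space UNIV) (\<lambda>\<omega>. (int n - int (G n \<omega>)) + int (E n \<omega>))"
      unfolding distr G_def E_def dec by simp
  qed
  moreover have "(\<lambda>n. measure (M n) {\<omega> \<in> space (M n). E n \<omega> = 1}) \<longlonglongrightarrow> 1 / 4"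
  proof (rule Lim_transform_eventually[OF alternating_falling_sum_asymptotics])
    have "measure (M n) {\<omega> \<in> space (M n). E n \<omega> = 1} = n * (1 - 2 * alternating_falling_sum n)"
      if n: "n \<ge> 1" for n
      unfolding J(4)[OF n, symmetric]
      by (simp add: M_def P_def E_def dec vimage_def)
    then show "\<forall>\<^sub>F n in sequentially. n * (1 - 2 * alternating_falling_sum n)
        = measure (M n) {\<omega> \<in> space (M n). E n \<omega> = 1}"
      by (intro eventually_sequentiallyI[of 1]) simp
  qed
  ultimately show ?thesis by blast
qed

end
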